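(* Let $m,n\geq1$ and $r\geq0$ be integers, let $(K,\partial_1,\dots,\partial_m)$ be a differential field of characteristic zero with $m$ commuting derivations, and let $L=K(a_i^\xi:(\xi,i)\in\Gamma(r))$ be a differential kernel over $K$. Suppose further that for every $(\tau,l)\in\gamma(L)\setminus\Gamma(r)$ and $1\leq i<j\leq m$ such that $(\tau-{\bf i},l)$ and $(\tau-{\bf j},l)$ are leaders of $L$, there exist a sequence of minimal leaders $(\eta_1,l),\dots,(\eta_s,l)$ of $L$ and indices $k_1,\dots,k_s\in\{1,\dots,m\}$ with $k_1=i$ and $k_s=j$ such that $\eta_\ell\leq\tau-{\bf k}_\ell$ for all $\ell=1,\dots,s$ (where ${\bf k}_\ell$ is the tuple with $1$ in entry $k_\ell$ and zeros elsewhere) and $$\deg\mathrm{LUB}(\eta_\ell,\eta_{\ell+1})\leq r\quad\text{for }\ell=1,\dots,s-1.$$ Then the differential kernel $L$ has a principal realization.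
   Context: Notation. $\mathbb N=\{0,1,2,\dots\}$, $\mathfrak n=\{1,\dots,n\}$. For $\xi=(u_1,\dots,u_m)\in\mathbb N^m$, $\deg\xi=u_1+\cdots+u_m$; $\deg(\xi,i)=\deg\xi$ for $(\xi,i)\in\mathbb N^m\times\mathfrak n$. $\Gamma(r)=\{\alpha\in\mathbb N^m\times\mathfrak n:\deg\alpha\leq r\}$. ${\bf k}\in\mathbb N^m$ is the tuple with $1$ in the $k$-th entry and zeros elsewhere. $(\xi,i)\leq(\tau,j)$ iff $i=j$ and $\xi\leq\tau$ in the product order of $\mathbb N^m$; $(\xi,i)\unlhd(\tau,j)$ iff $(\deg\xi,i,u_1,\dots,u_m)$ is less than or equal to $(\deg\tau,j,v_1,\dots,v_m)$ in the left lexicographic order, where $\xi=(u_1,\dots,u_m)$, $\tau=(v_1,\dots,v_m)$; $\lhd$ is the strict version. $\mathrm{LUB}(\eta,\tau)$ is the entrywise maximum of $\eta,\tau\in\mathbb N^m$. Differential kernels. A field extension $L=K(a_i^\xi:(\xi,i)\in\Gamma(r))$ (with indexed generators) is a differential kernel over $K$ of length $r$ if there are derivations $D_k:K(a_i^\xi:(\xi,i)\in\Gamma(r-1))\to L$ extending $\partial_k$ ($1\leq k\leq m$) with $D_ka_i^\xi=a_i^{\xi+{\bf k}}$ for all $(\xi,i)\in\Gamma(r-1)$. An element $(\tau,j)\in\mathbb N^m\times\mathfrak n$ is a leader of $L$ if there is $\eta\leq\tau$ with $\deg\eta\leq r$ such that $a_j^\eta$ is algebraic over $K(a_i^\xi:(\xi,i)\lhd(\eta,j))$;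 it is a minimal leader if no leader is strictly below it with respect to $\leq$. $\gamma(L)$ is the set of all $(\mathrm{LUB}(\eta,\tau),i)$ with $\eta\neq\tau$ and $(\eta,i),(\tau,i)$ both minimal leaders of $L$. A prolongation of $(L,D_1,\dots,D_m)$ of length $s\geq r$ is a differential kernel $L'=K(a_i^\xi:(\xi,i)\in\Gamma(s))$ over $K$ with derivations $D_k'$ such that $L'$ is a field extension of $L$ (with the same generators $a_i^\xi$ for $(\xi,i)\in\Gamma(r)$) and $D_k'$ extends $D_k$. It is generic if $L$ and $L'$ have the same set of minimal leaders. A tuple $g=(g_1,\dots,g_n)$ in a differential field extension $(M,\partial_1',\dots,\partial_m')$ of $K$ is a regular realization of $L$ if there is a $K$-isomorphism $K(a_i^\xi:(\xi,i)\in\Gamma(r))\to K((\partial')^\xi g_i:(\xi,i)\in\Gamma(r))$ mapping $a_i^\xi\mapsto(\partial')^\xi g_i$. It is a principal realization of $L$ if there is an infinite sequence of differential kernels $L=L_0,L_1,\dots$ of strictly increasing lengths, each a generic prolongation of the preceding one, such that $g$ is a regular realization of every $L_i$. *)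

theory Defs
  imports
    "HOL-Computational_Algebra.Polynomial"
    "HOL-Computational_Algebra.Fraction_Field"
    "HOL-Library.Poly_Mapping"
    "HOL-Library.Function_Algebras"
    "HOL-Library.Fun_Lexorder"
begin

section \<open>Fields inside an ambient field type\<close>

text \<open>
  A field is a subfield (as a set) of a type of class \<open>field\<close>; the ambient type has no other role.
  A field extension of \<open>F\<close> is a field together with a homomorphism from \<open>F\<close> into it, so that the
  two fields may live in different ambient types.
\<close>

definition is_subfield :: "'a::field set \<Rightarrow> bool" where
  "is_subfield F \<longleftrightarrow> 0 \<in> F \<and> 1 \<in> F \<and>
     (\<forall>x\<in>F. \<forall>y\<in>F. x + y \<in> F \<and> x * y \<in> F) \<and> (\<forall>x\<in>F. - x \<in> F \<and> inverse x \<in> F)"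

definition field_hom_on :: "'a::field set \<Rightarrow> ('a \<Rightarrow> 'b::field) \<Rightarrow> bool" where
  "field_hom_on F h \<longleftrightarrow> h 1 = 1 \<and>
     (\<forall>x\<in>F. \<forall>y\<in>F. h (x + y) = h x + h y \<and> h (x * y) = h x * h y)"

definition algebraic_over :: "'a::field set \<Rightarrow> 'a \<Rightarrow> bool" where
  "algebraic_over F x \<longleftrightarrow> (\<exists>p. p \<noteq> 0 \<and> (\<forall>i. coeff p i \<in> F) \<and> poly p x = 0)"

definition derivation_on :: "'a::field set \<Rightarrow> ('a \<Rightarrow> 'a) \<Rightarrow> bool" where
  "derivation_on F d \<longleftrightarrow>
     (\<forall>x\<in>F. \<forall>y\<in>F. d (x + y) = d x + d y \<and> d (x * y) = d x * y + x * d y)"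

definition differential_field :: "'a::field set \<Rightarrow> ('m \<Rightarrow> 'a \<Rightarrow> 'a) \<Rightarrow> bool" where
  "differential_field F d \<longleftrightarrow> is_subfield F \<and>
     (\<forall>k. derivation_on F (d k) \<and> d k ` F \<subseteq> F) \<and>
     (\<forall>k l. \<forall>x\<in>F. d k (d l x) = d l (d k x))"

text \<open>
  The differential field \<open>(M, d)\<close> is an extension, via \<open>\<kappa>\<close>, of the differential field consisting of
  the whole type \<open>'k\<close> with the derivations \<open>\<delta>\<close>.
\<close>

definition differential_extension ::
    "('m \<Rightarrow> 'k::field \<Rightarrow> 'k) \<Rightarrow> ('k \<Rightarrow> 'b::field) \<Rightarrow> 'b set \<Rightarrow> ('m \<Rightarrow> 'b \<Rightarrow> 'b) \<Rightarrow> bool" where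
  "differential_extension \<delta> \<kappa> M d \<longleftrightarrow> differential_field M d \<and>
     field_hom_on UNIV \<kappa> \<and> range \<kappa> \<subseteq> M \<and> (\<forall>k c. d k (\<kappa> c) = \<kappa> (\<delta> k c))"


section \<open>Multi-indices\<close>

text \<open>
  The index sets \<open>{1..m}\<close> and \<open>{1..n}\<close> are finite linearly ordered types \<open>'m\<close> and \<open>'n\<close> (nonempty, as
  all types are). On \<open>'m \<Rightarrow> nat\<close> the relation \<open>\<le>\<close>, the operations \<open>+\<close>, \<open>-\<close> (truncated) and the
  supremum \<open>sup\<close> (which is LUB) are pointwise, and \<open>less_fun\<close> is the strict left lexicographic order.
\<close>

type_synonym ('m, 'n) midx = "('m \<Rightarrow> nat) \<times> 'n"

definition mdeg :: "('m::finite \<Rightarrow> nat) \<Rightarrow> nat" where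
  "mdeg \<xi> = (\<Sum>k\<in>UNIV. \<xi> k)"

definition Gam :: "nat \<Rightarrow> ('m::finite, 'n) midx set" where
  "Gam r = {\<alpha>. mdeg (fst \<alpha>) \<le> r}"

text \<open>\<open>Gam_below r\<close> is \<open>Gam (r - 1)\<close> for \<open>r > 0\<close>, and empty for \<open>r = 0\<close>.\<close>

definition Gam_below :: "nat \<Rightarrow> ('m::finite, 'n) midx set" where
  "Gam_below r = {\<alpha>. mdeg (fst \<alpha>) < r}"

definition unit_idx :: "'m \<Rightarrow> 'm \<Rightarrow> nat" where
  "unit_idx k = (\<lambda>l. if l = k then 1 else 0)"

definition midx_le :: "('m, 'n) midx \<Rightarrow> ('m, 'n) midx \<Rightarrow> bool" where
  "midx_le \<alpha> \<beta> \<longleftrightarrow> snd \<alpha> = snd \<beta> \<and> fst \<alpha> \<le> fst \<beta>"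

definition midx_prec ::
    "('m::{finite,linorder}, 'n::linorder) midx \<Rightarrow> ('m, 'n) midx \<Rightarrow> bool" where
  "midx_prec \<alpha> \<beta> \<longleftrightarrow> mdeg (fst \<alpha>) < mdeg (fst \<beta>) \<or>
     mdeg (fst \<alpha>) = mdeg (fst \<beta>) \<and>
       (snd \<alpha> < snd \<beta> \<or> snd \<alpha> = snd \<beta> \<and> less_fun (fst \<alpha>) (fst \<beta>))"


section \<open>Differential kernels\<close>

text \<open>
  Only the values of \<open>gen\<close> on \<open>Gam len\<close> matter, and only the values of \<open>der k\<close> on the field
  generated by the \<open>gen \<alpha>\<close> with \<open>\<alpha> \<in> Gam (len - 1)\<close>. The ground field is the type \<open>'k\<close>, and \<open>base\<close>
  is its embedding.
\<close>

record ('k, 'm, 'n, 'a) kernel =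
  len :: nat
  base :: "'k \<Rightarrow> 'a"
  gen :: "('m, 'n) midx \<Rightarrow> 'a"
  der :: "'m \<Rightarrow> 'a \<Rightarrow> 'a"

definition adjoin :: "('k \<Rightarrow> 'a::field) \<Rightarrow> ('i \<Rightarrow> 'a) \<Rightarrow> 'i set \<Rightarrow> 'a set" where
  "adjoin \<iota> a A = is_subfield hull (range \<iota> \<union> a ` A)"

definition kernel_field :: "('k, 'm::finite, 'n, 'a::field) kernel \<Rightarrow> 'a set" where
  "kernel_field L = adjoin (base L) (gen L) (Gam (len L))"

definition kernel_dom :: "('k, 'm::finite, 'n, 'a::field) kernel \<Rightarrow> 'a set" where
  "kernel_dom L = adjoin (base L) (gen L) (Gam_below (len L))"

definition differential_kernel ::
    "('m \<Rightarrow> 'k \<Rightarrow> 'k) \<Rightarrow> ('k::field, 'm::finite, 'n, 'a::field) kernel \<Rightarrow> bool" where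
  "differential_kernel \<delta> L \<longleftrightarrow> field_hom_on UNIV (base L) \<and>
     (\<forall>k. derivation_on (kernel_dom L) (der L k) \<and>
          der L k ` kernel_dom L \<subseteq> kernel_field L \<and>
          (\<forall>c. der L k (base L c) = base L (\<delta> k c)) \<and>
          (\<forall>(\<xi>, i) \<in> Gam_below (len L). der L k (gen L (\<xi>, i)) = gen L (\<xi> + unit_idx k, i)))"

definition leader ::
    "('k, 'm::{finite,linorder}, 'n::linorder, 'a::field) kernel \<Rightarrow> ('m, 'n) midx \<Rightarrow> bool" where
  "leader L \<alpha> \<longleftrightarrow> (\<exists>\<eta> \<le> fst \<alpha>. mdeg \<eta> \<le> len L \<and>
     algebraic_over (adjoin (base L) (gen L) {\<beta>. midx_prec \<beta> (\<eta>, snd \<alpha>)}) (gen L (\<eta>, snd \<alpha>)))"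

definition minimal_leader ::
    "('k, 'm::{finite,linorder}, 'n::linorder, 'a::field) kernel \<Rightarrow> ('m, 'n) midx \<Rightarrow> bool" where
  "minimal_leader L \<alpha> \<longleftrightarrow> leader L \<alpha> \<and> \<not> (\<exists>\<beta>. leader L \<beta> \<and> midx_le \<beta> \<alpha> \<and> \<beta> \<noteq> \<alpha>)"

definition gamma_set ::
    "('k, 'm::{finite,linorder}, 'n::linorder, 'a::field) kernel \<Rightarrow> ('m, 'n) midx set" where
  "gamma_set L = {(sup \<eta> \<tau>, i) | \<eta> \<tau> i.
     \<eta> \<noteq> \<tau> \<and> minimal_leader L (\<eta>, i) \<and> minimal_leader L (\<tau>, i)}"


section \<open>Prolongations and realizations\<close>

text \<open>The homomorphism \<open>h\<close> is the field extension \<open>L \<subseteq> L'\<close>.\<close>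

definition prolongation ::
    "('m \<Rightarrow> 'k \<Rightarrow> 'k) \<Rightarrow> ('k::field, 'm::finite, 'n, 'a::field) kernel \<Rightarrow>
     ('k, 'm, 'n, 'b::field) kernel \<Rightarrow> bool" where
  "prolongation \<delta> L L' \<longleftrightarrow>
     differential_kernel \<delta> L \<and> differential_kernel \<delta> L' \<and> len L \<le> len L' \<and>
     (\<exists>h. field_hom_on (kernel_field L) h \<and> h ` kernel_field L \<subseteq> kernel_field L' \<and>
          (\<forall>c. h (base L c) = base L' c) \<and>
          (\<forall>\<alpha>\<in>Gam (len L). h (gen L \<alpha>) = gen L' \<alpha>) \<and>
          (\<forall>k. \<forall>x\<in>kernel_dom L. der L' k (h x) = h (der L k x)))"

definition generic_prolongation ::
    "('m \<Rightarrow> 'k \<Rightarrow> 'k) \<Rightarrow> ('k::field, 'm::{finite,linorder}, 'n::linorder, 'a::field) kernel \<Rightarrow>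
     ('k, 'm, 'n, 'b::field) kernel \<Rightarrow> bool" where
  "generic_prolongation \<delta> L L' \<longleftrightarrow>
     prolongation \<delta> L L' \<and> {\<alpha>. minimal_leader L \<alpha>} = {\<alpha>. minimal_leader L' \<alpha>}"

text \<open>
  With \<open>'m = {1 < ... < m}\<close> and \<open>\<xi> = (u\<^sub>1, ..., u\<^sub>m)\<close>, this applies the \<open>u\<^sub>m\<close>-th power of \<open>d m\<close> first
  and the \<open>u\<^sub>1\<close>-th power of \<open>d 1\<close> last.
\<close>

definition iter_der :: "('m::{finite,linorder} \<Rightarrow> 'b \<Rightarrow> 'b) \<Rightarrow> ('m \<Rightarrow> nat) \<Rightarrow> 'b \<Rightarrow> 'b" where
  "iter_der d \<xi> = foldr (\<lambda>k. d k ^^ \<xi> k) (sorted_list_of_set UNIV)"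

definition regular_realization ::
    "('m \<Rightarrow> 'k \<Rightarrow> 'k) \<Rightarrow> ('k::field, 'm::{finite,linorder}, 'n, 'a::field) kernel \<Rightarrow>
     ('k \<Rightarrow> 'b::field) \<Rightarrow> 'b set \<Rightarrow> ('m \<Rightarrow> 'b \<Rightarrow> 'b) \<Rightarrow> ('n \<Rightarrow> 'b) \<Rightarrow> bool" where
  "regular_realization \<delta> L \<kappa> M d g \<longleftrightarrow>
     differential_extension \<delta> \<kappa> M d \<and> range g \<subseteq> M \<and>
     (\<exists>\<phi>. field_hom_on (kernel_field L) \<phi> \<and>
          bij_betw \<phi> (kernel_field L) (adjoin \<kappa> (\<lambda>(\<xi>, i). iter_der d \<xi> (g i)) (Gam (len L))) \<and>
          (\<forall>c. \<phi> (base L c) = \<kappa> c) \<and>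
          (\<forall>(\<xi>, i) \<in> Gam (len L). \<phi> (gen L (\<xi>, i)) = iter_der d \<xi> (g i)))"

text \<open>
  \<open>Ls i\<close> is the kernel \<open>L\<^bsub>i+1\<^esub>\<close> of the infinite sequence \<open>L = L\<^sub>0, L\<^sub>1, ...\<close>. Being isomorphic to a
  subfield of \<open>M\<close>, it can be taken in the ambient type of \<open>M\<close>.
\<close>

definition principal_realization ::
    "('m \<Rightarrow> 'k \<Rightarrow> 'k) \<Rightarrow> ('k::field, 'm::{finite,linorder}, 'n::linorder, 'a::field) kernel \<Rightarrow>
     ('k \<Rightarrow> 'b::field) \<Rightarrow> 'b set \<Rightarrow> ('m \<Rightarrow> 'b \<Rightarrow> 'b) \<Rightarrow> ('n \<Rightarrow> 'b) \<Rightarrow> bool" where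
  "principal_realization \<delta> L \<kappa> M d g \<longleftrightarrow>
     regular_realization \<delta> L \<kappa> M d g \<and>
     (\<exists>Ls :: nat \<Rightarrow> ('k, 'm, 'n, 'b) kernel.
        len L < len (Ls 0) \<and> generic_prolongation \<delta> L (Ls 0) \<and>
        (\<forall>i. len (Ls i) < len (Ls (Suc i)) \<and> generic_prolongation \<delta> (Ls i) (Ls (Suc i))) \<and>
        (\<forall>i. regular_realization \<delta> (Ls i) \<kappa> M d g))"

text \<open>
  Rational functions over \<open>'a\<close> in countably many indeterminates. HOL cannot quantify existentially
  over types, so a type has to be named in which realizations are sought. This one is large enough:
  a generic prolongation of a kernel is generated over it by algebraically independent elements,
  so the differential field generated by a principal realization of a kernel in \<open>'a\<close> embeds
  into this type.
\<close>

type_synonym 'a ratfun = "((nat \<Rightarrow>\<^sub>0 nat) \<Rightarrow>\<^sub>0 'a) fract"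

end

theory Submission
  imports Defs "HOL-Library.Countable"
begin

text \<open>
  All generators \<open>a\<^sub>i\<^sup>\<xi>\<close> are constructed at once, by recursion along the order of the indices, in the
  field of rational functions over the ambient field of \<open>L\<close>. Beyond the length of \<open>L\<close>, a generator
  that is not a leader is a new indeterminate, and a leader \<open>(\<tau>, l)\<close> must be the \<open>k\<close>-th derivative of
  the generator at \<open>\<tau> - k\<close> for every \<open>k\<close> such that \<open>(\<tau> - k, l)\<close> is a leader. In characteristic zero a
  derivation extends to every larger field, uniquely to algebraic elements and with arbitrary values
  at transcendental ones, so the only obstruction is that these derivatives may disagree.

  If \<open>(\<tau> - k, l)\<close> and \<open>(\<tau> - k', l)\<close> lie above a common leader with \<open>k \<noteq> k'\<close>, then \<open>(\<tau> - k - k', l)\<close>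
  is a leader, its generator is algebraic over the preceding ones, and the commutator of the two
  derivations, which vanishes on those, vanishes on it too; so the two derivatives agree. If they lie
  above leaders \<open>\<eta>\<close> and \<open>\<eta>'\<close> whose least upper bound is not \<open>\<tau>\<close>, they are compared through a third
  direction. The remaining case, \<open>(\<tau>, l) \<in> \<gamma>(L)\<close>, is reduced to this one by the chain of minimal
  leaders in the hypothesis. Truncating the resulting differential field gives the sequence of
  generic prolongations.
\<close>

section \<open>Extending derivations\<close>

text \<open>
  A derivation is represented by its graph, a subring of the dual numbers: the pair \<open>(a, a')\<close> stands
  for \<open>a + a' \<epsilon>\<close>, and the last clause says that the relation is single-valued.
\<close>

definition der_graph :: "('a::field \<times> 'a) set \<Rightarrow> bool" where
  "der_graph H \<longleftrightarrow> (1, 0) \<in> H \<and>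
     (\<forall>a a' b b'. (a, a') \<in> H \<longrightarrow> (b, b') \<in> H \<longrightarrow> (a - b, a' - b') \<in> H \<and> (a * b, a' * b + a * b') \<in> H) \<and>
     (\<forall>z. (0, z) \<in> H \<longrightarrow> z = 0)"

lemma der_graphD:
  assumes "der_graph H"
  shows "(1, 0) \<in> H"
    and "(a, a') \<in> H \<Longrightarrow> (b, b') \<in> H \<Longrightarrow> (a - b, a' - b') \<in> H"
    and "(a, a') \<in> H \<Longrightarrow> (b, b') \<in> H \<Longrightarrow> (a * b, a' * b + a * b') \<in> H"
    and "(0, z) \<in> H \<Longrightarrow> z = 0"
  using assms unfolding der_graph_def by blast+

lemma der_graph_zero: "der_graph H \<Longrightarrow> (0, 0) \<in> H"
  using der_graphD(2)[of H 1 0 1 0] der_graphD(1)[of H] by simp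

lemma der_graph_add:
  assumes "der_graph H" "(a, a') \<in> H" "(b, b') \<in> H"
  shows "(a + b, a' + b') \<in> H"
proof -
  have "(0 - b, 0 - b') \<in> H"
    using der_graphD(2)[OF assms(1) der_graph_zero[OF assms(1)] assms(3)] .
  from der_graphD(2)[OF assms(1,2) this] show ?thesis by simp
qed

lemma der_graph_unique:
  assumes "der_graph H" "(a, a') \<in> H" "(a, b') \<in> H"
  shows "a' = b'"
  using der_graphD(2)[OF assms] der_graphD(4)[OF assms(1), of "a' - b'"] by simp

lemma der_graph_sum:
  assumes "der_graph H" "finite A" "\<And>i. i \<in> A \<Longrightarrow> (f i, g i) \<in> H"
  shows "(sum f A, sum g A) \<in> H"
  using assms(2,3)
proof (induction A rule: finite_induct)
  case empty
  then show ?case using der_graph_zero[OF assms(1)] by simp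
next
  case (insert x F)
  then show ?case using der_graph_add[OF assms(1)] by simp
qed

text \<open>The quotient rule: these are the fractions of the dual numbers
  \<open>u + u' \<epsilon>\<close> and \<open>v + v' \<epsilon>\<close> with invertible
  denominator.\<close>

definition quot_graph :: "('a::field \<times> 'a) set \<Rightarrow> ('a \<times> 'a) set" where
  "quot_graph H = {(u / v, (u' * v - u * v') / v\<^sup>2) | u u' v v'. (u, u') \<in> H \<and> (v, v') \<in> H \<and> v \<noteq> 0}"

lemma quot_graphI:
  assumes "(u, u') \<in> H" "(v, v') \<in> H" "v \<noteq> 0" "a = u / v" "a' = (u' * v - u * v') / v\<^sup>2"
  shows "(a, a') \<in> quot_graph H"
  using assms unfolding quot_graph_def by blast

lemma quot_graphE:
  assumes "(a, a') \<in> quot_graph H"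
  obtains u u' v v' where "(u, u') \<in> H" "(v, v') \<in> H" "v \<noteq> 0" "a = u / v" "a' = (u' * v - u * v') / v\<^sup>2"
  using assms unfolding quot_graph_def by blast

lemma subset_quot_graph:
  assumes "der_graph H" shows "H \<subseteq> quot_graph H"
proof
  fix z assume "z \<in> H"
  then show "z \<in> quot_graph H"
    using quot_graphI[of "fst z" "snd z" H 1 0 "fst z" "snd z"] der_graphD(1)[OF assms] by simp
qed

lemma der_graph_quot:
  assumes H: "der_graph H"
  shows "der_graph (quot_graph H)"
  unfolding der_graph_def
proof (intro conjI allI impI)
  show "(1, 0) \<in> quot_graph H"
    using subset_quot_graph[OF H] der_graphD(1)[OF H] by blast
  fix z assume "(0, z) \<in> quot_graph H"
  then show "z = 0"
    by (elim quot_graphE) (use der_graphD(4)[OF H] in auto)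
next
  fix a a' b b' assume a: "(a, a') \<in> quot_graph H" and b: "(b, b') \<in> quot_graph H"
  obtain u u' v v' where 1: "(u, u') \<in> H" "(v, v') \<in> H" "v \<noteq> 0" "a = u / v" "a' = (u' * v - u * v') / v\<^sup>2"
    using a by (elim quot_graphE)
  obtain s s' t t' where 2: "(s, s') \<in> H" "(t, t') \<in> H" "t \<noteq> 0" "b = s / t" "b' = (s' * t - s * t') / t\<^sup>2"
    using b by (elim quot_graphE)
  note m = der_graphD(3)[OF H]
  have vt: "(v * t, v' * t + v * t') \<in> H" using m[OF 1(2) 2(2)] .
  show "(a - b, a' - b') \<in> quot_graph H"
    by (rule quot_graphI[OF der_graphD(2)[OF H m[OF 1(1) 2(2)] m[OF 2(1) 1(2)]] vt])
       (use 1(3) 2(3) in \<open>simp_all add: 1(4,5) 2(4,5) field_simps power2_eq_square\<close>)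
  show "(a * b, a' * b + a * b') \<in> quot_graph H"
    by (rule quot_graphI[OF m[OF 1(1) 2(1)] vt])
       (use 1(3) 2(3) in \<open>simp_all add: 1(4,5) 2(4,5) field_simps power2_eq_square\<close>)
qed

lemma quot_graph_inverse:
  assumes H: "der_graph H" and a: "(a, a') \<in> quot_graph H"
  shows "\<exists>z. (inverse a, z) \<in> quot_graph H"
proof -
  obtain u u' v v' where 1: "(u, u') \<in> H" "(v, v') \<in> H" "v \<noteq> 0" "a = u / v"
    using a by (elim quot_graphE)
  show ?thesis
  proof (cases "u = 0")
    case True
    then show ?thesis using 1 der_graph_zero[OF der_graph_quot[OF H]] by auto
  next
    case False
    then show ?thesis using quot_graphI[OF 1(2,1) False, of "inverse a"] 1(4) by auto
  qed
qed

text \<open>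
  The candidate extension to the ring generated by \<open>x\<close> that sends \<open>x\<close> to \<open>y\<close>: the coefficients of
  \<open>q\<close> are the derivatives of the coefficients of \<open>p\<close>.
\<close>

definition poly_graph :: "('a::field \<times> 'a) set \<Rightarrow> 'a \<Rightarrow> 'a \<Rightarrow> ('a \<times> 'a) set" where
  "poly_graph G x y = {(poly p x, poly q x + poly (pderiv p) x * y) | p q. \<forall>i. (coeff p i, coeff q i) \<in> G}"

lemma coeff_mult_graph:
  assumes "der_graph G" "\<forall>i. (coeff p i, coeff q i) \<in> G" "\<forall>i. (coeff r i, coeff s i) \<in> G"
  shows "(coeff (p * r) i, coeff (q * r + p * s) i) \<in> G"
proof -
  have "(\<Sum>j\<le>i. coeff p j * coeff r (i - j), \<Sum>j\<le>i. coeff q j * coeff r (i - j) + coeff p j * coeff s (i - j)) \<in> G"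
    by (rule der_graph_sum[OF assms(1)]) (use assms der_graphD(3)[OF assms(1)] in auto)
  then show ?thesis by (simp add: coeff_mult sum.distrib)
qed

text \<open>The assumption \<open>rel\<close> is single-valuedness at 0. Closure under products
  comes from the product rules for \<open>pderiv\<close> and for the coefficients.\<close>

lemma poly_graph:
  assumes G: "der_graph G"
    and rel: "\<forall>p q. (\<forall>i. (coeff p i, coeff q i) \<in> G) \<longrightarrow> poly p x = 0 \<longrightarrow> poly q x + poly (pderiv p) x * y = 0"
  shows "der_graph (poly_graph G x y)" "G \<subseteq> poly_graph G x y" "(x, y) \<in> poly_graph G x y"
proof -
  have one: "\<forall>i. (coeff 1 i, coeff 0 i) \<in> G"
    using der_graphD(1)[OF G] der_graph_zero[OF G] by (auto simp: coeff_1)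
  have "\<forall>i. (coeff [:0, 1:] i, coeff 0 i) \<in> G"
    using der_graphD(1)[OF G] der_graph_zero[OF G] by (auto simp: coeff_pCons split: nat.splits)
  then have "(poly [:0, 1:] x, poly 0 x + poly (pderiv [:0, 1:]) x * y) \<in> poly_graph G x y"
    unfolding poly_graph_def by blast
  then show "(x, y) \<in> poly_graph G x y" by (simp add: pderiv_pCons)
  show "G \<subseteq> poly_graph G x y"
  proof
    fix z assume "z \<in> G"
    then have "\<forall>i. (coeff [:fst z:] i, coeff [:snd z:] i) \<in> G"
      using der_graph_zero[OF G] by (auto simp: coeff_pCons split: nat.splits)
    then have "(poly [:fst z:] x, poly [:snd z:] x + poly (pderiv [:fst z:]) x * y) \<in> poly_graph G x y"
      unfolding poly_graph_def by blast
    then show "z \<in> poly_graph G x y" by simp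
  qed
  show "der_graph (poly_graph G x y)"
    unfolding der_graph_def
  proof (intro conjI allI impI)
    show "(1, 0) \<in> poly_graph G x y"
    proof -
      have "(poly 1 x, poly 0 x + poly (pderiv 1) x * y) \<in> poly_graph G x y"
        using one unfolding poly_graph_def by blast
      then show ?thesis by simp
    qed
  next
    fix z assume "(0, z) \<in> poly_graph G x y"
    then show "z = 0" using rel unfolding poly_graph_def by (auto simp: eq_commute[of 0])
  next
    fix a a' b b' assume "(a, a') \<in> poly_graph G x y" "(b, b') \<in> poly_graph G x y"
    then obtain p q r s where pq: "\<forall>i. (coeff p i, coeff q i) \<in> G" "\<forall>i. (coeff r i, coeff s i) \<in> G"
      and eq: "a = poly p x" "a' = poly q x + poly (pderiv p) x * y" 
        "b = poly r x" "b' = poly s x + poly (pderiv r) x * y"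
      unfolding poly_graph_def by auto
    have "\<forall>i. (coeff (p - r) i, coeff (q - s) i) \<in> G"
      using pq der_graphD(2)[OF G] by auto
    then have "(poly (p - r) x, poly (q - s) x + poly (pderiv (p - r)) x * y) \<in> poly_graph G x y"
      unfolding poly_graph_def by blast
    then show "(a - b, a' - b') \<in> poly_graph G x y"
      by (simp add: eq pderiv_diff algebra_simps)
    have "(poly (p * r) x, poly (q * r + p * s) x + poly (pderiv (p * r)) x * y) \<in> poly_graph G x y"
      using coeff_mult_graph[OF G pq] unfolding poly_graph_def by blast
    then show "(a * b, a' * b + a * b') \<in> poly_graph G x y"
      by (simp add: eq pderiv_mult algebra_simps)
  qed
qed

lemma graph_lift_poly:
  assumes G: "der_graph G" and p: "\<forall>i. coeff p i \<in> Domain G"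
  obtains q where "\<forall>i. (coeff p i, coeff q i) \<in> G"
proof -
  define d where "d a = (SOME a'. (a, a') \<in> G)" for a
  have d: "(a, d a) \<in> G" if "a \<in> Domain G" for a
    using that unfolding d_def by (auto intro: someI)
  \<comment> \<open>\<open>map_poly\<close> acts coefficientwise only for functions that fix
    0.\<close>
  have "d 0 = 0"
    using d der_graphD(4)[OF G] der_graph_zero[OF G] by blast
  then have "\<forall>i. (coeff p i, coeff (map_poly d p) i) \<in> G"
    using d p by (simp add: coeff_map_poly)
  then show thesis by (rule that)
qed

lemma minimal_annihilator:
  assumes "algebraic_over F x"
  obtains f where "f \<noteq> 0" "\<forall>i. coeff f i \<in> F" "poly f x = 0"
    "\<And>p. p \<noteq> 0 \<Longrightarrow> \<forall>i. coeff p i \<in> F \<Longrightarrow> poly p x = 0 \<Longrightarrow> degree f \<le> degree p"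
proof -
  let ?P = "\<lambda>p. p \<noteq> 0 \<and> (\<forall>i. coeff p i \<in> F) \<and> poly p x = 0"
  obtain p0 where "?P p0" using assms unfolding algebraic_over_def by blast
  from ex_has_least_nat[of ?P p0 degree, OF this] show thesis
    using that by blast
qed

lemma is_subfieldD:
  assumes "is_subfield F"
  shows "0 \<in> F" "1 \<in> F" "x \<in> F \<Longrightarrow> y \<in> F \<Longrightarrow> x + y \<in> F" "x \<in> F \<Longrightarrow> y \<in> F \<Longrightarrow> x * y \<in> F"
    "x \<in> F \<Longrightarrow> - x \<in> F" "x \<in> F \<Longrightarrow> inverse x \<in> F" "x \<in> F \<Longrightarrow> y \<in> F \<Longrightarrow> x - y \<in> F"
    "x \<in> F \<Longrightarrow> y \<in> F \<Longrightarrow> x / y \<in> F"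
proof -
  show 1: "0 \<in> F" "1 \<in> F" "x \<in> F \<Longrightarrow> y \<in> F \<Longrightarrow> x + y \<in> F" "x \<in> F \<Longrightarrow> y \<in> F \<Longrightarrow> x * y \<in> F"
    "x \<in> F \<Longrightarrow> - x \<in> F" "x \<in> F \<Longrightarrow> inverse x \<in> F" for x y
    using assms unfolding is_subfield_def by auto
  show "x \<in> F \<Longrightarrow> y \<in> F \<Longrightarrow> x - y \<in> F"
    using 1(3)[of x "- y"] 1(5)[of y] by simp
  show "x \<in> F \<Longrightarrow> y \<in> F \<Longrightarrow> x / y \<in> F"
    using 1(4)[of x "inverse y"] 1(6)[of y] by (simp add: divide_inverse)
qed

lemma is_subfield_sum: "is_subfield F \<Longrightarrow> (\<And>i. i \<in> A \<Longrightarrow> f i \<in> F) \<Longrightarrow> sum f A \<in> F"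
  by (induction A rule: infinite_finite_induct) (auto simp: is_subfieldD)

lemma is_subfield_of_nat: "is_subfield F \<Longrightarrow> of_nat n \<in> F"
  by (induction n) (auto simp: is_subfieldD)

lemma is_subfield_power: "is_subfield F \<Longrightarrow> x \<in> F \<Longrightarrow> x ^ n \<in> F"
  by (induction n) (auto simp: is_subfieldD)

lemma is_subfield_poly: "is_subfield F \<Longrightarrow> \<forall>i. coeff p i \<in> F \<Longrightarrow> x \<in> F \<Longrightarrow> poly p x \<in> F"
  by (simp add: poly_altdef is_subfield_sum is_subfieldD is_subfield_power)

text \<open>Separability in characteristic zero: the derivative of a nonconstant annihilator is a
  nonzero polynomial over \<open>F\<close> of smaller degree, so by minimality it cannot vanish at
  \<open>x\<close>.\<close>

lemma pderiv_minimal_annihilator_nonzero: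
  fixes x :: "'a::field_char_0"
  assumes F: "is_subfield F" and f: "f \<noteq> 0" "\<forall>i. coeff f i \<in> F" "poly f x = 0"
    and min: "\<And>p. p \<noteq> 0 \<Longrightarrow> \<forall>i. coeff p i \<in> F \<Longrightarrow> poly p x = 0 \<Longrightarrow> degree f \<le> degree p"
  shows "poly (pderiv f) x \<noteq> 0"
proof
  assume 0: "poly (pderiv f) x = 0"
  have "degree f > 0"
    using f by (metis degree_eq_zeroE gr0I pCons_0_0 poly_0_coeff_0 coeff_pCons_0 poly_pCons mult_zero_right add.right_neutral poly_0)
  moreover from this have "pderiv f \<noteq> 0" by (simp add: pderiv_eq_0_iff)
  moreover have "\<forall>i. coeff (pderiv f) i \<in> F"
    using f(2) by (simp add: coeff_pderiv is_subfieldD[OF F] is_subfield_of_nat[OF F] flip: of_nat_Suc)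
  ultimately show False
    using min[of "pderiv f"] 0 by (simp add: degree_pderiv)
qed

text \<open>Differentiating \<open>poly f x = 0\<close> for an annihilator \<open>f\<close> of least
  degree forces the value \<open>y\<close>. Any other relation \<open>poly p x = 0\<close> is
  compatible with it, because division by \<open>f\<close> reduces \<open>p\<close> to 0 together
  with its differentiated coefficients.\<close>

lemma algebraic_step_relation:
  fixes x :: "'a::field_char_0"
  assumes G: "der_graph G" and F: "is_subfield (Domain G)" and alg: "algebraic_over (Domain G) x"
  shows "\<exists>y. \<forall>p q. (\<forall>i. (coeff p i, coeff q i) \<in> G) \<longrightarrow> poly p x = 0 \<longrightarrow>
             poly q x + poly (pderiv p) x * y = 0"
proof -
  obtain f where f: "f \<noteq> 0" "\<forall>i. coeff f i \<in> Domain G" "poly f x = 0"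
    and min: "\<And>p. p \<noteq> 0 \<Longrightarrow> \<forall>i. coeff p i \<in> Domain G \<Longrightarrow> poly p x = 0 \<Longrightarrow> degree f \<le> degree p"
    using minimal_annihilator[OF alg] by metis
  obtain g where fg: "\<forall>i. (coeff f i, coeff g i) \<in> G"
    using graph_lift_poly[OF G f(2)] .
  have f': "poly (pderiv f) x \<noteq> 0"
    using pderiv_minimal_annihilator_nonzero[OF F f min] .
  define y where "y = - poly g x / poly (pderiv f) x"
  have y: "poly g x + poly (pderiv f) x * y = 0" using f' by (simp add: y_def)
  have "poly q x + poly (pderiv p) x * y = 0"
    if "\<forall>i. (coeff p i, coeff q i) \<in> G" "poly p x = 0" for p q
    using that
  proof (induction "degree p" arbitrary: p q rule: less_induct)
    case less
    show ?case
    proof (cases "p = 0")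
      case True
      then have "q = 0" using less.prems(1) der_graphD(4)[OF G] by (intro poly_eqI) simp
      then show ?thesis using True by simp
    next
      case False
      have dom: "\<forall>i. coeff p i \<in> Domain G" using less.prems by blast
      then have deg: "degree f \<le> degree p" using min False less.prems by blast
      have "lead_coeff p / lead_coeff f \<in> Domain G"
        using is_subfieldD(8)[OF F] dom f(2) by blast
      then obtain c' where c': "(lead_coeff p / lead_coeff f, c') \<in> G" by blast
      define c where "c = lead_coeff p / lead_coeff f"
      define n where "n = degree p - degree f"
      have m: "\<forall>i. (coeff (monom c n) i, coeff (monom c' n) i) \<in> G"
        using c' der_graph_zero[OF G] by (simp add: c_def)
      \<comment> \<open>One division step: the leading term of \<open>p\<close> is cancelled, and
        \<open>q1\<close> differentiates the coefficients of \<open>p1\<close> by the product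
        rule.\<close>
      define p1 where "p1 = p - monom c n * f"
      define q1 where "q1 = q - (monom c' n * f + monom c n * g)"
      have G1: "\<forall>i. (coeff p1 i, coeff q1 i) \<in> G"
        using coeff_mult_graph[OF G m fg] less.prems(1) der_graphD(2)[OF G]
        unfolding p1_def q1_def coeff_diff by blast
      have z: "poly p1 x = 0" using less.prems f by (simp add: p1_def)
      have "poly q1 x + poly (pderiv p1) x * y = 0"
      proof (cases "p1 = 0")
        case True
        then have "q1 = 0" using G1 der_graphD(4)[OF G] by (intro poly_eqI) simp
        then show ?thesis using True by simp
      next
        case p1: False
        have "degree p1 \<le> degree p"
          unfolding p1_def using deg
          by (intro degree_diff_le order.trans[OF degree_mult_le] order.trans[OF add_mono[OF degree_monom_le order.refl]])
             (auto simp: n_def)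
        moreover have "coeff p1 (degree p) = 0"
          using deg f(1) by (simp add: p1_def coeff_monom_mult n_def c_def)
        ultimately have "degree p1 < degree p"
          using p1 by (metis leading_coeff_0_iff le_neq_implies_less)
        then show ?thesis using less.hyps G1 z by blast
      qed
      \<comment> \<open>The relation for \<open>p\<close> changes by a multiple of the relation for
        \<open>f\<close>; all other terms contain the factor \<open>poly f x = 0\<close>.\<close>
      moreover have "poly q1 x + poly (pderiv p1) x * y
          = poly q x + poly (pderiv p) x * y - poly (monom c n) x * (poly g x + poly (pderiv f) x * y)"
        using f(3) unfolding p1_def q1_def pderiv_diff pderiv_mult by (simp add: algebra_simps)
      ultimately show ?thesis using y by simp
    qed
  qed
  then show ?thesis by blast
qed

text \<open>Zorn's lemma gives a maximal graph containing \<open>G\<close>. Being closed under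
  quotients, it has a field as domain; adjoining one more element, algebraic or not, cannot enlarge
  it, so the domain is everything.\<close>

lemma der_graph_total:
  fixes G :: "('a::field_char_0 \<times> 'a) set"
  assumes G: "der_graph G"
  shows "\<exists>D. derivation_on UNIV D \<and> (\<forall>a a'. (a, a') \<in> G \<longrightarrow> D a = a')"
proof -
  let ?A = "{H. der_graph H \<and> G \<subseteq> H}"
  have "\<exists>M\<in>?A. \<forall>X\<in>?A. M \<subseteq> X \<longrightarrow> X = M"
  proof (rule subset_Zorn_nonempty)
    show "?A \<noteq> {}" using G by blast
    fix C assume "C \<noteq> {}" and ch: "subset.chain ?A C"
    then obtain X0 where X0: "X0 \<in> C" by blast
    have C: "\<And>X. X \<in> C \<Longrightarrow> der_graph X \<and> G \<subseteq> X" using ch by (simp add: subset_chain_def subset_iff)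
    have U: "\<exists>X\<in>C. w \<in> X" if "w \<in> \<Union>C" for w
      using that by (simp only: Union_iff)
    have two: "\<exists>X\<in>C. z \<in> X \<and> w \<in> X" if "z \<in> \<Union>C" "w \<in> \<Union>C" for z w
    proof -
      from U[OF that(1)] obtain X where X: "X \<in> C" "z \<in> X" by (elim bexE)
      from U[OF that(2)] obtain Y where Y: "Y \<in> C" "w \<in> Y" by (elim bexE)
      have "X \<subseteq> Y \<or> Y \<subseteq> X" using ch X(1) Y(1) by (simp add: subset_chain_def)
      then show ?thesis using X Y by (metis subsetD)
    qed
    have "der_graph (\<Union>C)"
      unfolding der_graph_def
    proof (intro conjI allI impI)
      show "(1, 0) \<in> \<Union>C" by (rule UnionI[OF X0 der_graphD(1)[OF conjunct1[OF C[OF X0]]]])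
      fix z assume "(0, z) \<in> \<Union>C"
      from U[OF this] obtain X where X: "X \<in> C" "(0, z) \<in> X" by (elim bexE)
      show "z = 0" by (rule der_graphD(4)[OF conjunct1[OF C[OF X(1)]] X(2)])
    next
      fix a a' b b' assume "(a, a') \<in> \<Union>C" "(b, b') \<in> \<Union>C"
      from two[OF this] obtain X where X: "X \<in> C" "(a, a') \<in> X" "(b, b') \<in> X" by (elim bexE conjE)
      have dX: "der_graph X" using C[OF X(1)] by simp
      show "(a - b, a' - b') \<in> \<Union>C" "(a * b, a' * b + a * b') \<in> \<Union>C"
        by (rule UnionI[OF X(1) der_graphD(2)[OF dX X(2,3)]], rule UnionI[OF X(1) der_graphD(3)[OF dX X(2,3)]])
    qed
    moreover have "G \<subseteq> \<Union>C"
      by (rule order.trans[OF conjunct2[OF C[OF X0]] Union_upper[OF X0]])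
    ultimately show "\<Union>C \<in> ?A" by simp
  qed
  then obtain M where MA: "M \<in> ?A" and maxA: "\<forall>X\<in>?A. M \<subseteq> X \<longrightarrow> X = M" by (elim bexE)
  from MA have M: "der_graph M" "G \<subseteq> M" by simp_all
  have max: "X = M" if "der_graph X" "M \<subseteq> X" for X
    using maxA that order.trans[OF M(2) that(2)] by simp
  have q: "quot_graph M = M"
    using max[OF der_graph_quot subset_quot_graph] M(1) by simp
  have inv: "inverse a \<in> Domain M" if "a \<in> Domain M" for a
    using quot_graph_inverse[OF M(1)] that unfolding q Domain_iff by metis
  have F: "is_subfield (Domain M)"
    unfolding is_subfield_def
  proof (intro conjI ballI)
    show "0 \<in> Domain M" "1 \<in> Domain M"
      using der_graph_zero[OF M(1)] der_graphD(1)[OF M(1)] by (auto intro: DomainI)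
    fix x assume x: "x \<in> Domain M"
    show "inverse x \<in> Domain M" using inv x .
    show "- x \<in> Domain M"
      using x der_graphD(2)[OF M(1) der_graph_zero[OF M(1)], of x] unfolding Domain_iff by (metis diff_0)
    fix y assume y: "y \<in> Domain M"
    show "x + y \<in> Domain M" using x y der_graph_add[OF M(1)] unfolding Domain_iff by metis
    show "x * y \<in> Domain M" using x y der_graphD(3)[OF M(1)] unfolding Domain_iff by metis
  qed
  have full: "x \<in> Domain M" for x
  proof -
    have "\<exists>y. \<forall>p q. (\<forall>i. (coeff p i, coeff q i) \<in> M) \<longrightarrow> poly p x = 0 \<longrightarrow>
             poly q x + poly (pderiv p) x * y = 0"
    proof (cases "algebraic_over (Domain M) x")
      case True
      then show ?thesis using algebraic_step_relation[OF M(1) F] by blast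
    next
      case False
      \<comment> \<open>At a transcendental \<open>x\<close> every value of the derivation is
        consistent; 0 is taken.\<close>
      have "poly q x + poly (pderiv p) x * 0 = 0"
        if "\<forall>i. (coeff p i, coeff q i) \<in> M" "poly p x = 0" for p q
      proof -
        have "p = 0" using False that unfolding algebraic_over_def by blast
        then have "q = 0" using that der_graphD(4)[OF M(1)] by (intro poly_eqI) simp
        then show ?thesis by simp
      qed
      then show ?thesis by blast
    qed
    then obtain y where "\<forall>p q. (\<forall>i. (coeff p i, coeff q i) \<in> M) \<longrightarrow> poly p x = 0 \<longrightarrow>
        poly q x + poly (pderiv p) x * y = 0"
      by (elim exE)
    note pg = poly_graph[OF M(1) this]
    have "(x, y) \<in> M" using pg(3) max[OF pg(1,2)] by simp
    then show ?thesis by (rule DomainI)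
  qed
  define D where "D a = (THE a'. (a, a') \<in> M)" for a
  have D: "(a, a') \<in> M \<longleftrightarrow> D a = a'" for a a'
  proof -
    obtain b where b: "(a, b) \<in> M" using full[of a] unfolding Domain_iff by (elim exE)
    have "D a = b" unfolding D_def by (rule the_equality, rule b, rule der_graph_unique[OF M(1) _ b])
    then show ?thesis using b der_graph_unique[OF M(1) b] by metis
  qed
  have "derivation_on UNIV D"
    unfolding derivation_on_def
    using der_graph_add[OF M(1), unfolded D] der_graphD(3)[OF M(1), unfolded D] by simp
  moreover have "D a = a'" if "(a, a') \<in> G" for a a'
    using subsetD[OF M(2) that] D by simp
  ultimately show ?thesis by (intro exI[of _ D] conjI allI impI)
qed

section \<open>Derivations of the whole field\<close>

definition derivation :: "('a::field \<Rightarrow> 'a) \<Rightarrow> bool" where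
  "derivation D \<longleftrightarrow> derivation_on UNIV D"

lemma derivationD:
  assumes "derivation D"
  shows "D (x + y) = D x + D y" "D (x * y) = D x * y + x * D y" "D 0 = 0" "D 1 = 0"
    "D (- x) = - D x" "D (x - y) = D x - D y" "D (inverse x) = - D x * inverse x * inverse x"
proof -
  show 1: "D (x + y) = D x + D y" "D (x * y) = D x * y + x * D y" for x y
    using assms unfolding derivation_def derivation_on_def by auto
  show 2: "D 0 = 0" using 1(1)[of 0 0] by (metis add_0 add_cancel_right_right)
  show 3: "D 1 = 0" using 1(2)[of 1 1] by (metis add_cancel_right_right mult_1 mult_1_right)
  show 4: "D (- x) = - D x" for x using 1(1)[of x "- x"] 2 by (simp add: eq_neg_iff_add_eq_0 add.commute)
  show "D (x - y) = D x - D y" using 1(1)[of x "- y"] 4 by simp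
  show "D (inverse x) = - D x * inverse x * inverse x"
  proof (cases "x = 0")
    case False
    then have "D x * inverse x + x * D (inverse x) = 0"
      using 1(2)[of x "inverse x"] 3 by simp
    then have "inverse x * (D x * inverse x + x * D (inverse x)) = 0" by simp
    then have "inverse x * D x * inverse x + D (inverse x) = 0"
      using False by (simp add: distrib_left mult.assoc[symmetric])
    then show ?thesis by (simp add: eq_neg_iff_add_eq_0 add.commute mult.commute)
  qed (use 2 in simp)
qed

lemma derivation_diff_fun: "derivation D \<Longrightarrow> derivation E \<Longrightarrow> derivation (\<lambda>x. D x - E x)"
  unfolding derivation_def derivation_on_def by (auto simp: algebra_simps)

lemma derivation_commutator:
  "derivation D \<Longrightarrow> derivation E \<Longrightarrow> derivation (\<lambda>x. D (E x) - E (D x))"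
  unfolding derivation_def[of "\<lambda>x. D (E x) - E (D x)"] derivation_on_def
  by (auto simp: derivationD algebra_simps)

lemma derivation_poly:
  assumes D: "derivation D"
  shows "D (poly p x) = poly (map_poly D p) x + poly (pderiv p) x * D x"
proof (induction p)
  case 0
  then show ?case by (simp add: derivationD[OF D])
next
  case (pCons a p)
  then show ?case
    by (simp add: derivationD[OF D] map_poly_pCons pderiv_pCons algebra_simps)
qed

text \<open>Differentiating a minimal annihilator \<open>f\<close> of \<open>x\<close> gives
  \<open>D x = - poly (map_poly D f) x / poly (pderiv f) x\<close>, a quotient of elements of
  \<open>G\<close>.\<close>

lemma derivation_algebraic_mem:
  fixes x :: "'a::field_char_0"
  assumes D: "derivation D" and F: "is_subfield F" and G: "is_subfield G" and FG: "F \<subseteq> G"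
    and DF: "\<And>z. z \<in> F \<Longrightarrow> D z \<in> G" and alg: "algebraic_over F x" and x: "x \<in> G"
  shows "D x \<in> G"
proof -
  obtain f where f: "f \<noteq> 0" "\<forall>i. coeff f i \<in> F" "poly f x = 0"
    and min: "\<And>p. p \<noteq> 0 \<Longrightarrow> \<forall>i. coeff p i \<in> F \<Longrightarrow> poly p x = 0 \<Longrightarrow> degree f \<le> degree p"
    using minimal_annihilator[OF alg] by metis
  have f': "poly (pderiv f) x \<noteq> 0"
    using pderiv_minimal_annihilator_nonzero[OF F f min] .
  have "poly (map_poly D f) x + poly (pderiv f) x * D x = 0"
    using derivation_poly[OF D, of f x] f(3) by (simp add: derivationD(3)[OF D])
  then have eq: "D x = - poly (map_poly D f) x / poly (pderiv f) x"
    by (metis add.commute eq_neg_iff_add_eq_0 mult.commute nonzero_eq_divide_eq[OF f'])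
  have "poly (map_poly D f) x \<in> G"
    by (rule is_subfield_poly[OF G _ x]) (use f(2) DF in \<open>simp add: coeff_map_poly derivationD(3)[OF D]\<close>)
  moreover have "poly (pderiv f) x \<in> G"
    by (rule is_subfield_poly[OF G _ x])
      (use f(2) FG in \<open>auto simp only: coeff_pderiv intro!: is_subfieldD(4)[OF G] is_subfield_of_nat[OF G]\<close>)
  ultimately show ?thesis unfolding eq by (intro is_subfieldD(5,8)[OF G])
qed

text \<open>In the differentiated relation for a minimal annihilator \<open>f\<close> the term with
  \<open>map_poly D f\<close> drops out, and \<open>poly (pderiv f) x\<close> is nonzero.\<close>

lemma derivation_algebraic_zero:
  fixes x :: "'a::field_char_0"
  assumes D: "derivation D" and F: "is_subfield F"
    and DF: "\<And>z. z \<in> F \<Longrightarrow> D z = 0" and alg: "algebraic_over F x"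
  shows "D x = 0"
proof -
  obtain f where f: "f \<noteq> 0" "\<forall>i. coeff f i \<in> F" "poly f x = 0"
    and min: "\<And>p. p \<noteq> 0 \<Longrightarrow> \<forall>i. coeff p i \<in> F \<Longrightarrow> poly p x = 0 \<Longrightarrow> degree f \<le> degree p"
    using minimal_annihilator[OF alg] by metis
  have "poly (map_poly D f) x + poly (pderiv f) x * D x = D 0"
    using derivation_poly[OF D, of f x] unfolding f(3) by (rule sym)
  moreover have "map_poly D f = 0"
  proof (rule poly_eqI)
    fix i
    have "D (coeff f i) = 0" by (rule DF) (simp add: f(2))
    then show "coeff (map_poly D f) i = coeff 0 i"
      by (simp add: coeff_map_poly derivationD(3)[OF D])
  qed
  ultimately have "poly (pderiv f) x * D x = 0" by (simp add: derivationD(3)[OF D])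
  moreover have "poly (pderiv f) x \<noteq> 0"
    using pderiv_minimal_annihilator_nonzero[OF F f min] .
  ultimately show ?thesis by simp
qed

lemma derivation_algebraic_eq:
  fixes x :: "'a::field_char_0"
  assumes D: "derivation D" and E: "derivation E" and F: "is_subfield F"
    and DE: "\<And>z. z \<in> F \<Longrightarrow> D z = E z" and alg: "algebraic_over F x"
  shows "D x = E x"
  using derivation_algebraic_zero[OF derivation_diff_fun[OF D E] F _ alg] DE by simp

lemma is_subfield_derivation_kernel: "derivation D \<Longrightarrow> is_subfield {x. D x = 0}"
  unfolding is_subfield_def by (auto simp: derivationD)

lemma derivation_on_zero_one:
  assumes "derivation_on F d" "is_subfield F"
  shows "d 0 = 0" "d 1 = 0"
proof -
  have "d (0 + 0) = d 0 + d 0" "d (1 * 1) = d 1 * 1 + 1 * d 1"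
    using assms unfolding derivation_on_def by (blast intro: is_subfieldD)+
  then show "d 0 = 0" "d 1 = 0"
    by (metis add_0 add_cancel_right_right, metis add_cancel_right_right mult_1 mult_1_right)
qed

lemma derivation_on_graph:
  assumes d: "derivation_on F d" and F: "is_subfield F"
  shows "der_graph {(x, x'). x \<in> F \<and> x' = d x}"
proof -
  have diff: "d (a - b) = d a - d b" if "a \<in> F" "b \<in> F" for a b
  proof -
    have "d (a - b + b) = d (a - b) + d b"
      using d that(2) is_subfieldD(7)[OF F that] unfolding derivation_on_def by blast
    then show ?thesis by (simp add: eq_diff_eq)
  qed
  have mult: "d (a * b) = d a * b + a * d b" if "a \<in> F" "b \<in> F" for a b
    using d that unfolding derivation_on_def by blast
  show ?thesis
    unfolding der_graph_def mem_Collect_eq case_prod_conv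
    using derivation_on_zero_one[OF assms] is_subfieldD(2)[OF F] is_subfieldD(7)[OF F]
      is_subfieldD(4)[OF F] diff mult by metis
qed

lemma derivation_extend:
  fixes d :: "'a::field_char_0 \<Rightarrow> 'a"
  assumes "derivation_on F d" "is_subfield F"
  obtains D where "derivation D" "\<And>x. x \<in> F \<Longrightarrow> D x = d x"
proof -
  from der_graph_total[OF derivation_on_graph[OF assms]] obtain D
    where D: "derivation_on UNIV D" "\<forall>a a'. (a, a') \<in> {(x, x'). x \<in> F \<and> x' = d x} \<longrightarrow> D a = a'"
    by (elim exE conjE)
  then show thesis using that[of D] by (simp add: derivation_def)
qed

text \<open>A transcendental \<open>x\<close> satisfies no nontrivial polynomial relation, so
  \<open>poly_graph\<close> is single-valued whatever \<open>y\<close> is.\<close>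

lemma derivation_extend_transcendental:
  fixes d :: "'a::field_char_0 \<Rightarrow> 'a"
  assumes d: "derivation_on F d" and F: "is_subfield F" and x: "\<not> algebraic_over F x"
  obtains D where "derivation D" "\<And>z. z \<in> F \<Longrightarrow> D z = d z" "D x = y"
proof -
  let ?G = "{(x, x'). x \<in> F \<and> x' = d x}"
  note G = derivation_on_graph[OF d F]
  have rel: "poly q x + poly (pderiv p) x * y = 0"
    if "\<forall>i. (coeff p i, coeff q i) \<in> ?G" "poly p x = 0" for p q
  proof -
    have "p = 0" using x that unfolding algebraic_over_def by blast
    then have "q = 0" using that der_graphD(4)[OF G] by (intro poly_eqI) simp
    then show ?thesis using \<open>p = 0\<close> by simp
  qed
  then have "\<forall>p q. (\<forall>i. (coeff p i, coeff q i) \<in> ?G) \<longrightarrow> poly p x = 0 \<longrightarrow> poly q x + poly (pderiv p) x * y = 0"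
    by blast
  note pg = poly_graph[OF G this]
  from der_graph_total[OF pg(1)] obtain D
    where D: "derivation_on UNIV D" "\<forall>a a'. (a, a') \<in> poly_graph ?G x y \<longrightarrow> D a = a'"
    by (elim exE conjE)
  have "D z = d z" if "z \<in> F" for z
    using D(2) subsetD[OF pg(2)] that by simp
  moreover have "D x = y" using D(2) pg(3) by simp
  ultimately show thesis using that[of D] D(1) unfolding derivation_def by simp
qed

section \<open>Generated subfields\<close>

lemma is_subfield_adjoin: "is_subfield (adjoin \<iota> a A)"
  unfolding adjoin_def
proof (rule hull_in)
  fix T assume "\<forall>F\<in>T. is_subfield F"
  then show "is_subfield (\<Inter>T)" unfolding is_subfield_def by simp
qed

lemma adjoin_base: "\<iota> c \<in> adjoin \<iota> a A"
  unfolding adjoin_def by (rule hull_inc) simp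

lemma adjoin_gen: "\<alpha> \<in> A \<Longrightarrow> a \<alpha> \<in> adjoin \<iota> a A"
  unfolding adjoin_def by (rule hull_inc) simp

lemma adjoin_least:
  assumes "is_subfield F" "\<And>c. \<iota> c \<in> F" "\<And>\<alpha>. \<alpha> \<in> A \<Longrightarrow> a \<alpha> \<in> F"
  shows "adjoin \<iota> a A \<subseteq> F"
  unfolding adjoin_def by (rule hull_minimal) (use assms in auto)

lemma adjoin_subset:
  assumes "\<And>\<alpha>. \<alpha> \<in> A \<Longrightarrow> a \<alpha> \<in> adjoin \<iota> b B"
  shows "adjoin \<iota> a A \<subseteq> adjoin \<iota> b B"
  by (rule adjoin_least[OF is_subfield_adjoin adjoin_base assms])

lemma adjoin_mono: "A \<subseteq> B \<Longrightarrow> adjoin \<iota> a A \<subseteq> adjoin \<iota> a B"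
  by (rule adjoin_subset) (auto intro: adjoin_gen)

lemma adjoin_cong: "(\<And>\<alpha>. \<alpha> \<in> A \<Longrightarrow> a \<alpha> = b \<alpha>) \<Longrightarrow> adjoin \<iota> a A = adjoin \<iota> b A"
  unfolding adjoin_def by (metis image_cong)

text \<open>The zeros of the derivation \<open>D - E\<close> form a subfield, so testing generators
  is enough.\<close>

lemma derivations_agree_adjoin:
  assumes "derivation D" "derivation E" "\<And>c. D (\<iota> c) = E (\<iota> c)" "\<And>\<alpha>. \<alpha> \<in> A \<Longrightarrow> D (a \<alpha>) = E (a \<alpha>)"
    and "x \<in> adjoin \<iota> a A"
  shows "D x = E x"
proof -
  have "adjoin \<iota> a A \<subseteq> {x. D x - E x = 0}"
    by (rule adjoin_least[OF is_subfield_derivation_kernel[OF derivation_diff_fun]])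
      (use assms(1-4) in auto)
  then show ?thesis using assms(5) by auto
qed

text \<open>By the sum, product and quotient rules, the elements of \<open>G\<close> with derivative
  in \<open>G\<close> form a subfield.\<close>

lemma derivation_adjoin_mem:
  assumes D: "derivation D" and G: "is_subfield G"
    and "\<And>c. \<iota> c \<in> G" "\<And>c. D (\<iota> c) \<in> G" "\<And>\<alpha>. \<alpha> \<in> A \<Longrightarrow> a \<alpha> \<in> G" "\<And>\<alpha>. \<alpha> \<in> A \<Longrightarrow> D (a \<alpha>) \<in> G"
    and x: "x \<in> adjoin \<iota> a A"
  shows "D x \<in> G"
proof -
  note DD = derivationD[OF D] and GD = is_subfieldD[OF G]
  have "is_subfield {x. x \<in> G \<and> D x \<in> G}"
    unfolding is_subfield_def mem_Collect_eq
  proof (intro conjI ballI)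
    show "0 \<in> G" "1 \<in> G" "D 0 \<in> G" "D 1 \<in> G" using GD(1,2) DD(3,4) by simp_all
    fix x assume "x \<in> {x. x \<in> G \<and> D x \<in> G}"
    then have x: "x \<in> G" "D x \<in> G" by simp_all
    show "- x \<in> G" "inverse x \<in> G" using GD(5,6) x by simp_all
    show "D (- x) \<in> G" unfolding DD(5) by (rule GD(5)[OF x(2)])
    show "D (inverse x) \<in> G" unfolding DD(7)
      by (rule GD(4)[OF GD(4)[OF GD(5)[OF x(2)] GD(6)[OF x(1)]] GD(6)[OF x(1)]])
    fix y assume "y \<in> {x. x \<in> G \<and> D x \<in> G}"
    then have y: "y \<in> G" "D y \<in> G" by simp_all
    show "x + y \<in> G" by (rule GD(3)[OF x(1) y(1)])
    show "x * y \<in> G" by (rule GD(4)[OF x(1) y(1)])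
    show "D (x + y) \<in> G" unfolding DD(1) by (rule GD(3)[OF x(2) y(2)])
    show "D (x * y) \<in> G" unfolding DD(2)
      by (rule GD(3)[OF GD(4)[OF x(2) y(1)] GD(4)[OF x(1) y(2)]])
  qed
  from adjoin_least[OF this, of \<iota> A a] show ?thesis using assms(3-6) x by auto
qed

lemma field_hom_onD:
  assumes "field_hom_on UNIV h"
  shows "h (x + y) = h x + h y" "h (x * y) = h x * h y" "h 1 = 1" "h 0 = 0" "h (- x) = - h x"
    "h (x - y) = h x - h y" "h (inverse x) = inverse (h x)" "inj h"
proof -
  show 1: "h (x + y) = h x + h y" "h (x * y) = h x * h y" "h 1 = 1" for x y
    using assms unfolding field_hom_on_def by simp_all
  show 2: "h 0 = 0" using 1(1)[of 0 0] by (metis add_0 add_cancel_right_right)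
  show 3: "h (- x) = - h x" for x 
    using minus_unique[of "h x" "h (- x)"] 1(1)[of x "- x"] 2 by simp
  show 4: "h (x - y) = h x - h y" for x y using 1(1)[of x "- y"] 3[of y] by simp
  show "h (inverse x) = inverse (h x)"
  proof (cases "x = 0")
    case False
    then have "h x * h (inverse x) = 1" using 1(2)[of x "inverse x"] 1(3) by simp
    from inverse_unique[OF this] show ?thesis by (rule sym)
  qed (simp add: 2)
  show "inj h"
  proof (rule injI)
    fix x y assume "h x = h y"
    then have "h (x - y) = 0" using 4 by simp
    moreover have "h z \<noteq> 0" if "z \<noteq> 0" for z
    proof
      assume "h z = 0"
      then have "h (z * inverse z) = 0" by (simp only: 1(2) mult_zero_left)
      then show False using 1(3) that by simp
    qed
    ultimately show "x = y" by (metis eq_iff_diff_eq_0)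
  qed
qed

lemma is_subfield_image:
  assumes h: "field_hom_on UNIV h" and F: "is_subfield F"
  shows "is_subfield (h ` F)"
  unfolding is_subfield_def
proof (intro conjI ballI)
  note hD = field_hom_onD[OF h]
  show "0 \<in> h ` F" by (rule image_eqI[OF _ is_subfieldD(1)[OF F]]) (simp add: hD(4))
  show "1 \<in> h ` F" by (rule image_eqI[OF _ is_subfieldD(2)[OF F]]) (simp add: hD(3))
  fix x assume "x \<in> h ` F"
  then obtain u where u: "x = h u" "u \<in> F" by (rule imageE)
  show "- x \<in> h ` F" by (rule image_eqI[OF _ is_subfieldD(5)[OF F u(2)]]) (simp add: u(1) hD(5))
  show "inverse x \<in> h ` F" by (rule image_eqI[OF _ is_subfieldD(6)[OF F u(2)]]) (simp add: u(1) hD(7))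
  fix y assume "y \<in> h ` F"
  then obtain v where v: "y = h v" "v \<in> F" by (rule imageE)
  show "x + y \<in> h ` F"
    by (rule image_eqI[OF _ is_subfieldD(3)[OF F u(2) v(2)]]) (simp add: u(1) v(1) hD(1))
  show "x * y \<in> h ` F"
    by (rule image_eqI[OF _ is_subfieldD(4)[OF F u(2) v(2)]]) (simp add: u(1) v(1) hD(2))
qed

lemma is_subfield_vimage:
  assumes h: "field_hom_on UNIV h" and F: "is_subfield F"
  shows "is_subfield (h -` F)"
  using F unfolding is_subfield_def vimage_def by (simp add: field_hom_onD[OF h])

lemma adjoin_image:
  assumes h: "field_hom_on UNIV h"
  shows "h ` adjoin \<iota> a A = adjoin (\<lambda>c. h (\<iota> c)) (\<lambda>\<alpha>. h (a \<alpha>)) A"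
proof
  have "adjoin \<iota> a A \<subseteq> h -` adjoin (\<lambda>c. h (\<iota> c)) (\<lambda>\<alpha>. h (a \<alpha>)) A"
    by (rule adjoin_least[OF is_subfield_vimage[OF h is_subfield_adjoin]])
      (auto intro: adjoin_base adjoin_gen[where a = "\<lambda>\<alpha>. h (a \<alpha>)"])
  then show "h ` adjoin \<iota> a A \<subseteq> adjoin (\<lambda>c. h (\<iota> c)) (\<lambda>\<alpha>. h (a \<alpha>)) A" by blast
  show "adjoin (\<lambda>c. h (\<iota> c)) (\<lambda>\<alpha>. h (a \<alpha>)) A \<subseteq> h ` adjoin \<iota> a A"
    by (rule adjoin_least[OF is_subfield_image[OF h is_subfield_adjoin]])
      (auto intro: adjoin_base adjoin_gen)
qed

text \<open>Annihilating polynomials are carried forward by \<open>h\<close> and back by its inverse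
  on the image of \<open>F\<close>.\<close>

lemma algebraic_over_image:
  assumes h: "field_hom_on UNIV h" and F: "is_subfield F"
  shows "algebraic_over (h ` F) (h x) \<longleftrightarrow> algebraic_over F x"
proof -
  note hD = field_hom_onD[OF h]
  have poly: "poly (map_poly h p) (h x) = h (poly p x)" for p
    by (induction p) (simp_all add: hD map_poly_pCons)
  have h0: "h z = 0 \<longleftrightarrow> z = 0" for z using hD(4) inj_eq[OF hD(8), of z 0] by simp
  show ?thesis
  proof
    assume "algebraic_over F x"
    then obtain p where p: "p \<noteq> 0" "\<forall>i. coeff p i \<in> F" "poly p x = 0"
      unfolding algebraic_over_def by (elim exE conjE)
    have "map_poly h p \<noteq> 0" using p(1) h0 by (simp add: map_poly_eq_0_iff)
    moreover have "\<forall>i. coeff (map_poly h p) i \<in> h ` F" using p(2) by (simp add: coeff_map_poly hD(4))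
    moreover have "poly (map_poly h p) (h x) = 0" by (simp add: poly p(3) hD(4))
    ultimately show "algebraic_over (h ` F) (h x)" unfolding algebraic_over_def by blast
  next
    assume "algebraic_over (h ` F) (h x)"
    then obtain q where q: "q \<noteq> 0" "\<forall>i. coeff q i \<in> h ` F" "poly q (h x) = 0"
      unfolding algebraic_over_def by (elim exE conjE)
    let ?g = "inv_into F h"
    have g: "?g z \<in> F" "h (?g z) = z" if "z \<in> h ` F" for z
      using that by (auto intro: inv_into_into f_inv_into_f)
    have g0: "?g 0 = 0"
      using g[of 0] is_subfieldD(1)[OF is_subfield_image[OF h F]] h0 by metis
    have c: "coeff (map_poly ?g q) i = ?g (coeff q i)" for i by (simp add: coeff_map_poly g0)
    have "map_poly h (map_poly ?g q) = q"
      by (rule poly_eqI) (use g(2) q(2) in \<open>simp add: coeff_map_poly[of h] hD(4) c\<close>)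
    then have "map_poly ?g q \<noteq> 0" "poly (map_poly ?g q) x = 0"
      using q(1,3) poly[of "map_poly ?g q"] h0 by auto
    moreover have "\<forall>i. coeff (map_poly ?g q) i \<in> F" using c g(1) q(2) by simp
    ultimately show "algebraic_over F x" unfolding algebraic_over_def by blast
  qed
qed

lemma algebraic_over_mem:
  assumes "is_subfield F" "x \<in> F" shows "algebraic_over F x"
  unfolding algebraic_over_def
  by (rule exI[of _ "[:- x, 1:]"])
    (use assms in \<open>auto simp: coeff_pCons is_subfieldD split: nat.splits\<close>)

text \<open>The derivation is carried to the image of \<open>F\<close> through \<open>inv h\<close>,
  a left inverse of the injective \<open>h\<close>, and then extended to the whole target
  field.\<close>

lemma derivation_transfer:
  fixes h :: "'a::field \<Rightarrow> 'b::field_char_0"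
  assumes h: "field_hom_on UNIV h" and F: "is_subfield F" and d: "derivation_on F d"
  obtains D where "derivation D" "\<And>x. x \<in> F \<Longrightarrow> D (h x) = h (d x)"
proof -
  note hD = field_hom_onD[OF h]
  let ?e = "\<lambda>z. h (d (inv h z))"
  have e: "?e (h x) = h (d x)" for x using hD(8) by (simp add: inv_f_f)
  have "derivation_on (h ` F) ?e"
    unfolding derivation_on_def
  proof (intro ballI)
    fix x y assume "x \<in> h ` F" "y \<in> h ` F"
    then obtain u v where uv: "x = h u" "u \<in> F" "y = h v" "v \<in> F" by (elim imageE)
    have d': "d (u + v) = d u + d v" "d (u * v) = d u * v + u * d v"
      using d uv(2,4) unfolding derivation_on_def by simp_all
    have "?e (h u + h v) = ?e (h u) + ?e (h v)"
      unfolding hD(1)[symmetric] e d' by (simp add: hD(1))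
    moreover have "?e (h u * h v) = ?e (h u) * h v + h u * ?e (h v)"
      unfolding hD(2)[symmetric] e d' by (simp add: hD(1,2))
    ultimately show "?e (x + y) = ?e x + ?e y \<and> ?e (x * y) = ?e x * y + x * ?e y"
      unfolding uv(1,3) by simp
  qed
  from derivation_extend[OF this is_subfield_image[OF h F]] obtain D
    where D: "derivation D" "\<And>z. z \<in> h ` F \<Longrightarrow> D z = ?e z" by metis
  have "D (h x) = h (d x)" if "x \<in> F" for x
    using D(2)[OF imageI[OF that]] e by simp
  then show thesis using that D(1) by blast
qed

section \<open>Indeterminates of the field of rational functions\<close>

text \<open>The extension results for derivations are stated in characteristic zero; this makes them
  available for rational functions.\<close>

instance fract :: ("{idom, ring_char_0}") field_char_0
proof
  show "inj (of_nat :: nat \<Rightarrow> 'a fract)"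
    by (rule injI) (simp add: of_nat_fract eq_fract)
qed

definition rconst :: "'a::field_char_0 \<Rightarrow> 'a ratfun" where
  "rconst c = Fract (Poly_Mapping.single 0 c) 1"

definition rvar :: "nat \<Rightarrow> 'a::field_char_0 ratfun" where
  "rvar n = Fract (Poly_Mapping.single (Poly_Mapping.single n 1) 1) 1"

lemma field_hom_rconst: "field_hom_on UNIV rconst"
  unfolding field_hom_on_def rconst_def
  by (simp add: single_add mult_single One_fract_def)

lemma rvar_nonzero: "rvar n \<noteq> 0"
proof -
  have "Poly_Mapping.single (Poly_Mapping.single n (1::nat)) (1::'a) \<noteq> 0"
    by (metis lookup_single_eq lookup_zero zero_neq_one)
  then show ?thesis unfolding rvar_def Zero_fract_def by (simp add: eq_fract)
qed

text \<open>The Euler operator \<open>X\<^sub>n \<partial>/\<partial>X\<^sub>n\<close>.\<close>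

definition euler :: "nat \<Rightarrow> ((nat \<Rightarrow>\<^sub>0 nat) \<Rightarrow>\<^sub>0 'a::field_char_0) \<Rightarrow> ((nat \<Rightarrow>\<^sub>0 nat) \<Rightarrow>\<^sub>0 'a)" where
  "euler n p = Poly_Mapping.mapp (\<lambda>k c. of_nat (Poly_Mapping.lookup k n) * c) p"

lemma lookup_euler:
  "Poly_Mapping.lookup (euler n p) k = of_nat (Poly_Mapping.lookup k n) * Poly_Mapping.lookup p k"
  unfolding euler_def by (simp add: lookup_mapp when_def in_keys_iff)

lemma euler_add: "euler n (p + q) = euler n p + euler n q"
  by (rule poly_mapping_eqI) (simp add: lookup_euler lookup_add algebra_simps)

lemma euler_minus: "euler n (p - q) = euler n p - euler n q"
  by (rule poly_mapping_eqI) (simp add: lookup_euler lookup_minus algebra_simps)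

lemma euler_zero [simp]: "euler n 0 = 0"
  by (rule poly_mapping_eqI) (simp add: lookup_euler)

lemma euler_single:
  "euler n (Poly_Mapping.single k c) = Poly_Mapping.single k (of_nat (Poly_Mapping.lookup k n) * c)"
  by (rule poly_mapping_eqI) (simp add: lookup_euler lookup_single when_def)

lemma poly_mapping_add_induct [case_names zero single add]:
  fixes p :: "'i \<Rightarrow>\<^sub>0 'b::comm_monoid_add"
  assumes "P 0" "\<And>k c. P (Poly_Mapping.single k c)" "\<And>p q. P p \<Longrightarrow> P q \<Longrightarrow> P (p + q)"
  shows "P p"
proof (induction p rule: update_induct)
  case const
  then show ?case by (rule assms(1))
next
  case (update p k c)
  have "Poly_Mapping.update k c p = p + Poly_Mapping.single k c"
    using update(1)
    by (intro poly_mapping_eqI) (auto simp: lookup_update lookup_add lookup_single when_def in_keys_iff)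
  then show ?case using assms(2,3) update by simp
qed

text \<open>Both sides are additive in \<open>p\<close> and in \<open>q\<close>, and on two
  monomials the exponents of variable \<open>n\<close> add.\<close>

lemma euler_mult: "euler n (p * q) = euler n p * q + p * euler n q"
proof (induction p rule: poly_mapping_add_induct)
  case zero
  show ?case by simp
next
  case (add p p')
  then show ?case by (simp add: distrib_right euler_add)
next
  case (single k c)
  show ?case
  proof (induction q rule: poly_mapping_add_induct)
    case zero
    show ?case by simp
  next
    case (add q q')
    then show ?case by (simp add: distrib_left euler_add)
  next
    case (single l d)
    show ?case
      by (simp add: mult_single euler_single lookup_add distrib_right distrib_left mult.assoc mult.left_commute
          flip: single_add)
  qed
qed

text \<open>The Euler operator is a derivation of the polynomial ring and extends to fractions by
  \<open>der_graph_total\<close>. It singles out one variable, which serves to prove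
  transcendence.\<close>

lemma rvar_derivation:
  obtains D where "derivation D" "\<And>c. D (rconst c :: 'a::field_char_0 ratfun) = 0"
    "\<And>k. k \<noteq> n \<Longrightarrow> D (rvar k) = 0" "D (rvar n) \<noteq> 0"
proof -
  define H :: "('a ratfun \<times> 'a ratfun) set"
    where "H = (\<lambda>p. (Fract p 1, Fract (euler n p) 1)) ` UNIV"
  have H: "(a, a') \<in> H \<longleftrightarrow> (\<exists>p. a = Fract p 1 \<and> a' = Fract (euler n p) 1)" for a a'
    unfolding H_def by (auto simp only: image_iff prod.inject)
  have "der_graph H"
    unfolding der_graph_def
  proof (intro conjI allI impI)
    show "(1, 0) \<in> H"
      unfolding H One_fract_def Zero_fract_def
      by (rule exI[of _ 1]) (simp add: euler_single flip: single_one)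
    fix z assume "(0, z) \<in> H"
    then obtain p where p: "0 = Fract p 1" "z = Fract (euler n p) 1" unfolding H by (elim exE conjE)
    from p(1) have "p = 0" unfolding Zero_fract_def by (simp add: eq_fract)
    then show "z = 0"
      using p(2) by (simp add: Zero_fract_def)
  next
    fix a a' b b' assume "(a, a') \<in> H" "(b, b') \<in> H"
    then obtain p q where p: "a = Fract p 1" "a' = Fract (euler n p) 1"
      and q: "b = Fract q 1" "b' = Fract (euler n q) 1" unfolding H by (elim exE conjE)
    show "(a - b, a' - b') \<in> H"
      unfolding H by (rule exI[of _ "p - q"]) (simp add: p q euler_minus)
    show "(a * b, a' * b + a * b') \<in> H"
      unfolding H by (rule exI[of _ "p * q"]) (simp add: p q euler_mult)
  qed
  from der_graph_total[OF this] obtain D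
    where D: "derivation_on UNIV D" "\<forall>a a'. (a, a') \<in> H \<longrightarrow> D a = a'" by (elim exE conjE)
  have D': "D (Fract p 1) = Fract (euler n p) 1" for p
    using D(2) unfolding H by blast
  show thesis
  proof
    show "derivation D" using D(1) by (simp add: derivation_def)
    show "D (rconst c) = 0" for c
      unfolding rconst_def D' by (simp add: euler_single Zero_fract_def)
    show "D (rvar k) = 0" if "k \<noteq> n" for k
      unfolding rvar_def D' using that by (simp add: euler_single lookup_single Zero_fract_def when_def)
    have "D (rvar n) = rvar n"
      unfolding rvar_def D' by (simp add: euler_single)
    then show "D (rvar n) \<noteq> 0" using rvar_nonzero by simp
  qed
qed

section \<open>Multi-indices and their order\<close>

lemma mdeg_add: "mdeg (\<xi> + \<eta>) = mdeg \<xi> + mdeg \<eta>"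
  unfolding mdeg_def by (simp add: sum.distrib)

lemma mdeg_unit_idx [simp]: "mdeg (unit_idx k) = 1"
  unfolding mdeg_def unit_idx_def by simp

lemma mdeg_mono: "\<xi> \<le> \<eta> \<Longrightarrow> mdeg \<xi> \<le> mdeg \<eta>"
  unfolding mdeg_def le_fun_def by (rule sum_mono) simp

text \<open>An entry where \<eta> falls short of \<tau> can be lowered. Its positivity is recorded
  because subtraction is truncated.\<close>

lemma le_diff_unit_idx:
  assumes "\<eta> \<le> \<tau>" "\<eta> \<noteq> \<tau>"
  obtains k where "\<tau> k > 0" "\<eta> \<le> \<tau> - unit_idx k"
proof -
  obtain k where "\<eta> k \<noteq> \<tau> k" using assms(2) by blast
  then have "\<eta> k < \<tau> k" using assms(1) by (simp add: le_fun_def le_neq_implies_less)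
  then have "\<tau> k > 0" "\<eta> \<le> \<tau> - unit_idx k"
    using assms(1) by (auto simp: le_fun_def unit_idx_def)
  then show thesis by (rule that)
qed

lemma finite_Gam: "finite (Gam d :: ('m::finite, 'n::finite) midx set)"
proof -
  have le: "f k \<le> mdeg f" for f :: "'m \<Rightarrow> nat" and k
    unfolding mdeg_def by (rule member_le_sum) auto
  have "finite {f :: 'm \<Rightarrow> nat. \<forall>k. (k \<in> UNIV \<longrightarrow> f k \<in> {..d}) \<and> (k \<notin> UNIV \<longrightarrow> f k = 0)}"
    by (rule finite_set_of_finite_funs) simp_all
  then have "finite {f :: 'm \<Rightarrow> nat. mdeg f \<le> d}"
    by (rule finite_subset[rotated]) (clarsimp, metis le order.trans)
  then have "finite ({f :: 'm \<Rightarrow> nat. mdeg f \<le> d} \<times> (UNIV :: 'n set))" by simp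
  moreover have "Gam d = {f :: 'm \<Rightarrow> nat. mdeg f \<le> d} \<times> (UNIV :: 'n set)"
    unfolding Gam_def by auto
  ultimately show ?thesis by simp
qed

definition up :: "('m, 'n) midx \<Rightarrow> 'm \<Rightarrow> ('m, 'n) midx" where
  "up \<alpha> k = (fst \<alpha> + unit_idx k, snd \<alpha>)"

definition dn :: "('m, 'n) midx \<Rightarrow> 'm \<Rightarrow> ('m, 'n) midx" where
  "dn \<alpha> k = (fst \<alpha> - unit_idx k, snd \<alpha>)"

lemma snd_up [simp]: "snd (up \<alpha> k) = snd \<alpha>" and snd_dn [simp]: "snd (dn \<alpha> k) = snd \<alpha>"
  by (simp_all add: up_def dn_def)

lemma up_dn: "fst \<alpha> k > 0 \<Longrightarrow> up (dn \<alpha> k) k = \<alpha>"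
  unfolding up_def dn_def by (intro prod_eqI ext) (auto simp: unit_idx_def)

lemma dn_up [simp]: "dn (up \<alpha> k) k = \<alpha>"
  unfolding up_def dn_def by (intro prod_eqI ext) (auto simp: unit_idx_def)

lemma up_pos [simp]: "fst (up \<alpha> k) k > 0"
  unfolding up_def by (simp add: unit_idx_def)

lemma up_commute: "up (up \<alpha> k) l = up (up \<alpha> l) k"
  unfolding up_def by (simp add: add.assoc add.commute[of "unit_idx k"])

lemma dn_commute: "dn (dn \<alpha> k) l = dn (dn \<alpha> l) k"
  unfolding dn_def by (intro prod_eqI ext) simp_all

lemma mdeg_up [simp]: "mdeg (fst (up \<alpha> k)) = Suc (mdeg (fst \<alpha>))"
  unfolding up_def by (simp add: mdeg_add)

lemma mdeg_dn: "fst \<alpha> k > 0 \<Longrightarrow> Suc (mdeg (fst (dn \<alpha> k))) = mdeg (fst \<alpha>)"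
  using mdeg_up[of "dn \<alpha> k" k] up_dn[of \<alpha> k] by simp

lemma midx_prec_irrefl [simp]: "\<not> midx_prec \<alpha> \<alpha>"
  unfolding midx_prec_def by (simp add: less_fun_irrefl)

lemma midx_prec_trans: "midx_prec \<alpha> \<beta> \<Longrightarrow> midx_prec \<beta> \<gamma> \<Longrightarrow> midx_prec \<alpha> \<gamma>"
  unfolding midx_prec_def using less_fun_trans[of "fst \<alpha>" "fst \<beta>" "fst \<gamma>"] by (elim disjE conjE) auto

lemma midx_prec_total: "midx_prec \<alpha> \<beta> \<or> \<alpha> = \<beta> \<or> midx_prec \<beta> \<alpha>"
proof -
  have "less_fun (fst \<alpha>) (fst \<beta>) \<or> fst \<alpha> = fst \<beta> \<or> less_fun (fst \<beta>) (fst \<alpha>)"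
    by (rule less_fun_trichotomy) simp
  then show ?thesis
    unfolding midx_prec_def prod_eq_iff
    using less_linear[of "mdeg (fst \<alpha>)" "mdeg (fst \<beta>)"] less_linear[of "snd \<alpha>" "snd \<beta>"] by metis
qed

lemma midx_prec_mdeg: "midx_prec \<alpha> \<beta> \<Longrightarrow> mdeg (fst \<alpha>) \<le> mdeg (fst \<beta>)"
  unfolding midx_prec_def by auto

lemma midx_prec_up: "midx_prec \<alpha> (up \<alpha> k)"
  unfolding midx_prec_def by simp

lemma midx_prec_dn: "fst \<alpha> k > 0 \<Longrightarrow> midx_prec (dn \<alpha> k) \<alpha>"
  using midx_prec_up[of "dn \<alpha> k" k] by (simp add: up_dn)

lemma less_fun_add:
  fixes f g h :: "'m::linorder \<Rightarrow> nat"
  shows "less_fun (f + h) (g + h) \<longleftrightarrow> less_fun f g"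
  unfolding less_fun_def by simp

text \<open>Adding the same unit vector on both sides preserves each part of the comparison; this is
  why derivations respect the order.\<close>

lemma midx_prec_up_up [simp]: "midx_prec (up \<alpha> k) (up \<beta> k) \<longleftrightarrow> midx_prec \<alpha> \<beta>"
  unfolding midx_prec_def mdeg_up snd_up by (simp add: up_def less_fun_add)

lemma finite_midx_prec:
  "finite {\<beta> :: ('m::{finite,linorder}, 'n::{finite,linorder}) midx. midx_prec \<beta> \<alpha>}"
  by (rule finite_subset[OF _ finite_Gam[of "mdeg (fst \<alpha>)"]]) (auto simp: Gam_def dest: midx_prec_mdeg)

text \<open>The degree is compared first, so initial segments are finite, and their cardinality
  strictly increases along the order.\<close>

lemma wf_midx_prec:
  "wf {(\<beta>, \<alpha> :: ('m::{finite,linorder}, 'n::{finite,linorder}) midx). midx_prec \<beta> \<alpha>}"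
proof (rule wf_subset[OF wf_measure[of "\<lambda>\<alpha>. card {\<beta>. midx_prec \<beta> \<alpha>}"]], clarify)
  fix \<alpha>1 \<alpha>2 \<beta>1 \<beta>2
  assume less: "midx_prec (\<beta>1, \<beta>2) (\<alpha>1 :: 'm \<Rightarrow> nat, \<alpha>2 :: 'n)"
  have "{\<gamma>. midx_prec \<gamma> (\<beta>1, \<beta>2)} \<subset> {\<gamma>. midx_prec \<gamma> (\<alpha>1, \<alpha>2)}"
    using less midx_prec_trans[OF _ less] midx_prec_irrefl by blast
  then have "card {\<gamma>. midx_prec \<gamma> (\<beta>1, \<beta>2)} < card {\<gamma>. midx_prec \<gamma> (\<alpha>1, \<alpha>2)}"
    by (rule psubset_card_mono[OF finite_midx_prec])
  then show "((\<beta>1, \<beta>2), (\<alpha>1, \<alpha>2)) \<in> measure (\<lambda>\<alpha>. card {\<beta>. midx_prec \<beta> \<alpha>})" by simp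
qed

lemma midx_prec_induct [case_names less]:
  fixes \<alpha> :: "('m::{finite,linorder}, 'n::{finite,linorder}) midx"
  assumes "\<And>\<alpha>. (\<And>\<beta>. midx_prec \<beta> \<alpha> \<Longrightarrow> P \<beta>) \<Longrightarrow> P \<alpha>"
  shows "P \<alpha>"
  by (rule wf_induct_rule[OF wf_midx_prec]) (use assms in simp)

lemma finite_midx_has_max:
  fixes A :: "('m::{finite,linorder}, 'n::linorder) midx set"
  assumes "finite A" "A \<noteq> {}"
  shows "\<exists>\<beta>\<in>A. \<forall>\<gamma>\<in>A. midx_prec \<gamma> \<beta> \<or> \<gamma> = \<beta>"
  using assms
proof (induction A rule: finite_ne_induct)
  case (singleton x)
  then show ?case by simp
next
  case (insert x A)
  from insert.IH obtain \<beta> where b: "\<beta> \<in> A" "\<forall>\<gamma>\<in>A. midx_prec \<gamma> \<beta> \<or> \<gamma> = \<beta>" by (elim bexE)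
  consider "midx_prec x \<beta> \<or> x = \<beta>" | "midx_prec \<beta> x" using midx_prec_total[of x \<beta>] by metis
  then show ?case
  proof cases
    case 1
    then show ?thesis using b by (intro bexI[of _ \<beta>]) simp_all
  next
    case 2
    have "\<forall>\<gamma>\<in>A. midx_prec \<gamma> x"
    proof
      fix \<gamma> assume "\<gamma> \<in> A"
      with b(2) have "midx_prec \<gamma> \<beta> \<or> \<gamma> = \<beta>" by simp
      then show "midx_prec \<gamma> x" using 2 midx_prec_trans[OF _ 2] by (elim disjE) simp_all
    qed
    then show ?thesis by (intro bexI[of _ x]) simp_all
  qed
qed

section \<open>Leaders\<close>

lemma leader_upward: "leader L \<alpha> \<Longrightarrow> midx_le \<alpha> \<beta> \<Longrightarrow> leader L \<beta>"
  unfolding leader_def midx_le_def by (elim exE conjE, simp) (blast intro: order.trans)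

text \<open>A leader of least degree below \<tau> is minimal, since passing strictly below lowers
  the degree.\<close>

lemma leader_above_minimal_leader:
  assumes "leader L (\<tau>, l)"
  obtains \<eta> where "minimal_leader L (\<eta>, l)" "\<eta> \<le> \<tau>"
proof -
  obtain \<eta> where \<eta>: "leader L (\<eta>, l)" "\<eta> \<le> \<tau>"
    and min: "\<And>\<zeta>. leader L (\<zeta>, l) \<and> \<zeta> \<le> \<tau> \<Longrightarrow> mdeg \<eta> \<le> mdeg \<zeta>"
    using ex_has_least_nat[of "\<lambda>\<eta>. leader L (\<eta>, l) \<and> \<eta> \<le> \<tau>" \<tau> mdeg] assms by blast
  have "minimal_leader L (\<eta>, l)"
    unfolding minimal_leader_def
  proof (intro conjI notI)
    show "leader L (\<eta>, l)" by (rule \<eta>)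
    assume "\<exists>\<beta>. leader L \<beta> \<and> midx_le \<beta> (\<eta>, l) \<and> \<beta> \<noteq> (\<eta>, l)"
    then obtain \<beta> where b: "leader L \<beta>" "midx_le \<beta> (\<eta>, l)" "\<beta> \<noteq> (\<eta>, l)" by (elim exE conjE)
    then obtain \<zeta> where z: "\<beta> = (\<zeta>, l)" "\<zeta> \<le> \<eta>" "\<zeta> \<noteq> \<eta>" unfolding midx_le_def by (cases \<beta>) auto
    obtain k where k: "\<eta> k > 0" "\<zeta> \<le> \<eta> - unit_idx k" using le_diff_unit_idx[OF z(2,3)] .
    have "Suc (mdeg \<zeta>) \<le> mdeg \<eta>"
      using mdeg_mono[OF k(2)] mdeg_dn[of "(\<eta>, l)" k] k(1) by (simp add: dn_def)
    moreover have "mdeg \<eta> \<le> mdeg \<zeta>" using min[of \<zeta>] b(1) z(1,2) \<eta>(2) by (auto intro: order.trans)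
    ultimately show False by simp
  qed
  then show thesis using \<eta>(2) by (rule that)
qed

lemma minimal_leaders_cong:
  assumes "\<And>\<alpha>. leader L \<alpha> \<longleftrightarrow> leader L' \<alpha>"
  shows "{\<alpha>. minimal_leader L \<alpha>} = {\<alpha>. minimal_leader L' \<alpha>}"
  unfolding minimal_leader_def using assms by simp

section \<open>The prolonged generators\<close>

locale prolongable_kernel =
  fixes \<delta> :: "'m::{finite,linorder} \<Rightarrow> 'k::field_char_0 \<Rightarrow> 'k"
    and L :: "('k, 'm, 'n::{finite,linorder}, 'a::field_char_0) kernel"
  assumes differential_field: "differential_field UNIV \<delta>"
    and differential_kernel: "differential_kernel \<delta> L"
    and chain: "\<And>\<tau> l i j.
      (\<tau>, l) \<in> gamma_set L - Gam (len L) \<Longrightarrow> i < j \<Longrightarrow>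
      \<tau> i > 0 \<Longrightarrow> leader L (\<tau> - unit_idx i, l) \<Longrightarrow>
      \<tau> j > 0 \<Longrightarrow> leader L (\<tau> - unit_idx j, l) \<Longrightarrow>
      \<exists>(s::nat) (\<eta> :: nat \<Rightarrow> 'm \<Rightarrow> nat) (k :: nat \<Rightarrow> 'm).
        s \<ge> 1 \<and> k 1 = i \<and> k s = j \<and>
        (\<forall>q\<in>{1..s}. minimal_leader L (\<eta> q, l) \<and> \<tau> (k q) > 0 \<and> \<eta> q \<le> \<tau> - unit_idx (k q)) \<and>
        (\<forall>q\<in>{1..<s}. mdeg (sup (\<eta> q) (\<eta> (Suc q))) \<le> len L)"
begin

definition base_map :: "'k \<Rightarrow> 'a ratfun" where
  "base_map c = rconst (base L c)"

definition extends_base :: "'m \<Rightarrow> ('a ratfun \<Rightarrow> 'a ratfun) \<Rightarrow> bool" where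
  "extends_base k D \<longleftrightarrow> derivation D \<and> (\<forall>c. D (base_map c) = base_map (\<delta> k c))"

text \<open>Only indices below \<alpha> are involved, as \<gamma> precedes
  \<open>up \<gamma> k\<close>; so the recursion can choose \<open>D\<close> from the values already
  constructed.\<close>

definition compat ::
    "(('m, 'n) midx \<Rightarrow> 'a ratfun) \<Rightarrow> ('m, 'n) midx \<Rightarrow> 'm \<Rightarrow> ('a ratfun \<Rightarrow> 'a ratfun) \<Rightarrow> bool" where
  "compat a \<alpha> k D \<longleftrightarrow> extends_base k D \<and> (\<forall>\<gamma>. midx_prec (up \<gamma> k) \<alpha> \<longrightarrow> D (a \<gamma>) = a (up \<gamma> k))"

lemma compatD:
  assumes "compat a \<alpha> k D"
  shows "derivation D" "D (base_map c) = base_map (\<delta> k c)" "midx_prec (up \<gamma> k) \<alpha> \<Longrightarrow> D (a \<gamma>) = a (up \<gamma> k)"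
  using assms unfolding compat_def extends_base_def by blast+

text \<open>These are the directions from which a leader beyond the length of \<open>L\<close> is
  forced to be a derivative. The positive entry ensures that truncated subtraction really steps
  down.\<close>

definition leader_below :: "('m, 'n) midx \<Rightarrow> 'm \<Rightarrow> bool" where
  "leader_below \<alpha> k \<longleftrightarrow> fst \<alpha> k > 0 \<and> leader L (dn \<alpha> k)"

text \<open>
  Beyond the length of \<open>L\<close>, a leader is the derivative of a lower leader and every other generator
  is a new indeterminate. The derivation is chosen among those compatible with the generators
  constructed so far; \<open>derivatives_agree\<close> below shows that the choices do not matter.
\<close>

definition next_gen :: "(('m, 'n) midx \<Rightarrow> 'a ratfun) \<Rightarrow> ('m, 'n) midx \<Rightarrow> 'a ratfun" where
  "next_gen a \<alpha> =
     (if mdeg (fst \<alpha>) \<le> len L then rconst (gen L \<alpha>)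
      else if \<exists>k. leader_below \<alpha> k then
        (let k = SOME k. leader_below \<alpha> k in (SOME D. compat a \<alpha> k D) (a (dn \<alpha> k)))
      else rvar (to_nat \<alpha>))"

definition gens :: "('m, 'n) midx \<Rightarrow> 'a ratfun" where
  "gens = wfrec {(\<beta>, \<alpha>). midx_prec \<beta> \<alpha>} next_gen"

definition pred_field :: "('m, 'n) midx \<Rightarrow> 'a ratfun set" where
  "pred_field \<alpha> = adjoin base_map gens {\<beta>. midx_prec \<beta> \<alpha>}"

text \<open>The recursion is admissible because \<open>next_gen\<close> reads \<open>a\<close> only
  below \<alpha>: through \<open>compat\<close> and at \<open>dn \<alpha> k\<close>.\<close>

lemma gens_unfold: "gens \<alpha> = next_gen gens \<alpha>"
proof -
  let ?R = "{(\<beta>, \<alpha> :: ('m, 'n) midx). midx_prec \<beta> \<alpha>}"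
  let ?g = "cut gens ?R \<alpha>"
  have g: "?g \<beta> = gens \<beta>" if "midx_prec \<beta> \<alpha>" for \<beta>
    using that by (simp add: cut_apply)
  have "compat ?g \<alpha> k D \<longleftrightarrow> compat gens \<alpha> k D" for k D
  proof -
    have "?g \<gamma> = gens \<gamma> \<and> ?g (up \<gamma> k) = gens (up \<gamma> k)" if "midx_prec (up \<gamma> k) \<alpha>" for \<gamma>
      using g[OF that] g[OF midx_prec_trans[OF midx_prec_up that]] by simp
    then show ?thesis unfolding compat_def by metis
  qed
  then have c: "compat ?g \<alpha> = compat gens \<alpha>" by (intro ext)
  have "next_gen ?g \<alpha> = next_gen gens \<alpha>"
  proof (cases "\<exists>k. leader_below \<alpha> k")
    case True
    have "?g (dn \<alpha> (SOME k. leader_below \<alpha> k)) = gens (dn \<alpha> (SOME k. leader_below \<alpha> k))"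
      using someI_ex[OF True] by (intro g midx_prec_dn) (simp add: leader_below_def)
    then show ?thesis by (simp only: next_gen_def c Let_def)
  next
    case False
    then show ?thesis by (simp only: next_gen_def if_False)
  qed
  then show ?thesis
    using wfrec[OF wf_midx_prec, of next_gen \<alpha>] unfolding gens_def by simp
qed

lemma gens_low: "mdeg (fst \<alpha>) \<le> len L \<Longrightarrow> gens \<alpha> = rconst (gen L \<alpha>)"
  by (simp add: gens_unfold[of \<alpha>] next_gen_def)

text \<open>The witness \<eta> of a leader has degree at most \<open>len L\<close>, hence differs
  from \<open>fst \<alpha>\<close>, and one can step down from \<alpha> while staying above
  it.\<close>

lemma high_leader_iff:
  assumes "len L < mdeg (fst \<alpha>)"
  shows "leader L \<alpha> \<longleftrightarrow> (\<exists>k. leader_below \<alpha> k)"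
proof
  assume "leader L \<alpha>"
  then obtain \<eta> where \<eta>: "\<eta> \<le> fst \<alpha>" "mdeg \<eta> \<le> len L"
    "algebraic_over (adjoin (base L) (gen L) {\<beta>. midx_prec \<beta> (\<eta>, snd \<alpha>)}) (gen L (\<eta>, snd \<alpha>))"
    unfolding leader_def by (elim exE conjE)
  have "\<eta> \<noteq> fst \<alpha>" using \<eta>(2) assms by auto
  then obtain k where k: "fst \<alpha> k > 0" "\<eta> \<le> fst \<alpha> - unit_idx k" using le_diff_unit_idx[OF \<eta>(1)] by metis
  have "leader L (dn \<alpha> k)"
    unfolding leader_def using \<eta>(2,3) k(2) by (intro exI[of _ \<eta>]) (simp add: dn_def)
  then show "\<exists>k. leader_below \<alpha> k" using k(1) unfolding leader_below_def by blast
next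
  assume "\<exists>k. leader_below \<alpha> k"
  then obtain k where "leader_below \<alpha> k" ..
  then show "leader L \<alpha>" unfolding leader_below_def
    by (elim conjE leader_upward) (simp add: midx_le_def dn_def le_fun_def)
qed

lemma gens_free:
  assumes "len L < mdeg (fst \<alpha>)" "\<not> leader L \<alpha>"
  shows "gens \<alpha> = rvar (to_nat \<alpha>)"
proof -
  have "\<not> (\<exists>k. leader_below \<alpha> k)" "\<not> mdeg (fst \<alpha>) \<le> len L" using assms high_leader_iff by simp_all
  then show ?thesis by (simp only: gens_unfold[of \<alpha>] next_gen_def if_False)
qed

lemma gens_leader:
  assumes "len L < mdeg (fst \<alpha>)" "leader L \<alpha>" "\<And>k. \<exists>D. compat gens \<alpha> k D"
  obtains k D where "leader_below \<alpha> k" "compat gens \<alpha> k D" "gens \<alpha> = D (gens (dn \<alpha> k))"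
proof -
  have ex: "\<exists>k. leader_below \<alpha> k" using assms(1,2) high_leader_iff by metis
  let ?k = "SOME k. leader_below \<alpha> k" and ?D = "SOME D. compat gens \<alpha> (SOME k. leader_below \<alpha> k) D"
  have "gens \<alpha> = ?D (gens (dn \<alpha> ?k))"
    unfolding gens_unfold[of \<alpha>] next_gen_def Let_def using ex assms(1) by simp
  with someI_ex[OF ex] someI_ex[OF assms(3)[of ?k]] show thesis by (rule that)
qed

text \<open>The derivation of \<open>L\<close> is transported along \<open>rconst\<close>, which
  maps the generators of \<open>L\<close> to those of degree at most \<open>len L\<close>.\<close>

lemma low_derivation:
  "\<exists>D. extends_base k D \<and> (\<forall>\<gamma>. mdeg (fst \<gamma>) < len L \<longrightarrow> D (gens \<gamma>) = gens (up \<gamma> k))"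
proof -
  have F: "is_subfield (kernel_dom L)" unfolding kernel_dom_def by (rule is_subfield_adjoin)
  have d: "derivation_on (kernel_dom L) (der L k)" "der L k (base L c) = base L (\<delta> k c)"
    "\<forall>(\<xi>, i) \<in> Gam_below (len L). der L k (gen L (\<xi>, i)) = gen L (\<xi> + unit_idx k, i)" for c
    using differential_kernel unfolding differential_kernel_def by simp_all
  obtain D where D: "derivation D" "\<And>x. x \<in> kernel_dom L \<Longrightarrow> D (rconst x) = rconst (der L k x)"
    using derivation_transfer[OF field_hom_rconst F d(1)] by metis
  have "extends_base k D"
    unfolding extends_base_def base_map_def
    using D(1) D(2)[unfolded kernel_dom_def, OF adjoin_base] d(2) by simp
  moreover have "D (gens \<gamma>) = gens (up \<gamma> k)" if "mdeg (fst \<gamma>) < len L" for \<gamma>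
  proof -
    have g: "\<gamma> \<in> Gam_below (len L)" using that unfolding Gam_below_def by simp
    then have "gen L \<gamma> \<in> kernel_dom L" unfolding kernel_dom_def by (rule adjoin_gen)
    moreover have "der L k (gen L \<gamma>) = gen L (up \<gamma> k)"
      using bspec[OF d(3) g] by (simp add: up_def case_prod_beta)
    ultimately show ?thesis
      using that D(2) by (simp add: gens_low)
  qed
  ultimately show ?thesis by blast
qed

section \<open>Derivatives of generators that are algebraic over their predecessors\<close>

lemma is_subfield_pred_field: "is_subfield (pred_field \<alpha>)"
  unfolding pred_field_def by (rule is_subfield_adjoin)

lemma base_map_pred_field: "base_map c \<in> pred_field \<alpha>"
  unfolding pred_field_def by (rule adjoin_base)

lemma gens_pred_field: "midx_prec \<beta> \<alpha> \<Longrightarrow> gens \<beta> \<in> pred_field \<alpha>"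
  unfolding pred_field_def by (rule adjoin_gen) simp

lemma pred_field_mono:
  assumes "midx_prec \<beta> \<alpha>"
  shows "pred_field \<beta> \<subseteq> pred_field \<alpha>"
  unfolding pred_field_def by (rule adjoin_mono) (use midx_prec_trans[OF _ assms] in auto)

lemma derivations_agree_pred_field:
  assumes "derivation D" "derivation E" "\<And>c. D (base_map c) = E (base_map c)"
    "\<And>\<gamma>. midx_prec \<gamma> \<beta> \<Longrightarrow> D (gens \<gamma>) = E (gens \<gamma>)"
    "algebraic_over (pred_field \<beta>) x"
  shows "D x = E x"
  by (rule derivation_algebraic_eq[OF assms(1,2) is_subfield_pred_field _ assms(5)])
    (rule derivations_agree_adjoin[OF assms(1-3)], use assms(4) in \<open>auto simp: pred_field_def\<close>)

text \<open>\<open>D\<close> sends generators preceding \<open>dn \<alpha> k\<close> to generators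
  preceding \<alpha>, hence \<open>pred_field (dn \<alpha> k)\<close> into
  \<open>pred_field \<alpha>\<close>; the algebraic generator follows by
  \<open>derivation_algebraic_mem\<close>.\<close>

lemma compat_pred_field:
  assumes D: "compat gens \<alpha> k D" and r: "leader_below \<alpha> k"
    and alg: "algebraic_over (pred_field (dn \<alpha> k)) (gens (dn \<alpha> k))"
  shows "D (gens (dn \<alpha> k)) \<in> pred_field \<alpha>"
proof -
  have pos: "fst \<alpha> k > 0" using r by (simp add: leader_below_def)
  note p = midx_prec_dn[OF pos]
  have D': "derivation D" "\<And>c. D (base_map c) = base_map (\<delta> k c)"
    "\<And>\<gamma>. midx_prec (up \<gamma> k) \<alpha> \<Longrightarrow> D (gens \<gamma>) = gens (up \<gamma> k)"
    using compatD[OF D] by blast+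
  have up: "midx_prec (up \<gamma> k) \<alpha>" if "midx_prec \<gamma> (dn \<alpha> k)" for \<gamma>
    using that midx_prec_up_up[of \<gamma> k "dn \<alpha> k"] up_dn[of \<alpha> k] pos by simp
  show ?thesis
  proof (rule derivation_algebraic_mem[OF D'(1) is_subfield_pred_field is_subfield_pred_field pred_field_mono[OF p] _ alg gens_pred_field[OF p]])
    fix z assume "z \<in> pred_field (dn \<alpha> k)"
    then show "D z \<in> pred_field \<alpha>"
      unfolding pred_field_def[of "dn \<alpha> k"]
    proof (rule derivation_adjoin_mem[OF D'(1) is_subfield_pred_field, rotated -1])
      show "base_map c \<in> pred_field \<alpha>" "D (base_map c) \<in> pred_field \<alpha>" for c using base_map_pred_field D'(2) by simp_all
      fix \<gamma> assume "\<gamma> \<in> {\<beta>. midx_prec \<beta> (dn \<alpha> k)}"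
      then have g: "midx_prec \<gamma> (dn \<alpha> k)" by simp
      show "gens \<gamma> \<in> pred_field \<alpha>" by (rule gens_pred_field[OF midx_prec_trans[OF g p]])
      show "D (gens \<gamma>) \<in> pred_field \<alpha>" using D'(3)[OF up[OF g]] gens_pred_field[OF up[OF g]] by simp
    qed
  qed
qed

text \<open>Both derivations agree on \<open>pred_field (dn \<alpha> k)\<close>, and extension to
  algebraic elements is unique.\<close>

lemma compat_agree_same:
  assumes D: "compat gens \<alpha> k D" and E: "compat gens \<alpha> k E" and pos: "fst \<alpha> k > 0"
    and alg: "algebraic_over (pred_field (dn \<alpha> k)) (gens (dn \<alpha> k))"
  shows "D (gens (dn \<alpha> k)) = E (gens (dn \<alpha> k))"
proof (rule derivations_agree_pred_field[OF _ _ _ _ alg])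
  show "derivation D" "derivation E" "D (base_map c) = E (base_map c)" for c
    using compatD(1,2)[OF D] compatD(1,2)[OF E] by simp_all
  fix \<gamma> assume "midx_prec \<gamma> (dn \<alpha> k)"
  then have "midx_prec (up \<gamma> k) \<alpha>"
    using midx_prec_up_up[of \<gamma> k "dn \<alpha> k"] up_dn[OF pos] by simp
  then show "D (gens \<gamma>) = E (gens \<gamma>)" using compatD(3)[OF D] compatD(3)[OF E] by simp
qed

text \<open>The commutator of two compatible derivations vanishes on \<open>pred_field \<beta>\<close>, hence on \<open>gens \<beta>\<close>, which is algebraic over it.\<close>

lemma compat_agree_common:
  assumes D: "compat gens \<alpha> k D" and E: "compat gens \<alpha> l E" and pos: "fst \<alpha> k > 0" "fst \<alpha> l > 0"
    and ne: "k \<noteq> l" and alg: "algebraic_over (pred_field (dn (dn \<alpha> k) l)) (gens (dn (dn \<alpha> k) l))"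
  shows "D (gens (dn \<alpha> k)) = E (gens (dn \<alpha> l))"
proof -
  define \<beta> where "\<beta> = dn (dn \<alpha> k) l"
  have D': "derivation D" "\<And>c. D (base_map c) = base_map (\<delta> k c)"
    "\<And>\<gamma>. midx_prec (up \<gamma> k) \<alpha> \<Longrightarrow> D (gens \<gamma>) = gens (up \<gamma> k)"
    using compatD[OF D] by blast+
  have E': "derivation E" "\<And>c. E (base_map c) = base_map (\<delta> l c)"
    "\<And>\<gamma>. midx_prec (up \<gamma> l) \<alpha> \<Longrightarrow> E (gens \<gamma>) = gens (up \<gamma> l)"
    using compatD[OF E] by blast+
  have "fst (dn \<alpha> k) l > 0" "fst (dn \<alpha> l) k > 0" using pos ne by (simp_all add: dn_def unit_idx_def)
  then have b: "up \<beta> l = dn \<alpha> k" "up \<beta> k = dn \<alpha> l"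
    unfolding \<beta>_def using up_dn dn_commute[of \<alpha> k l] by metis+
  have comm: "\<delta> k (\<delta> l c) = \<delta> l (\<delta> k c)" for c
    using differential_field unfolding differential_field_def by simp
  have zero: "derivation (\<lambda>x. 0 :: 'a ratfun)" unfolding derivation_def derivation_on_def by simp
  have "D (E (gens \<beta>)) - E (D (gens \<beta>)) = 0"
  proof (rule derivations_agree_pred_field[OF derivation_commutator[OF D'(1) E'(1)] zero])
    show "algebraic_over (pred_field \<beta>) (gens \<beta>)" unfolding \<beta>_def by (rule alg)
    show "D (E (base_map c)) - E (D (base_map c)) = 0" for c by (simp add: D'(2) E'(2) comm)
    fix \<gamma> assume g: "midx_prec \<gamma> \<beta>"
    have 1: "midx_prec (up (up \<gamma> l) k) \<alpha>"
    proof -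
      have "midx_prec (up (up \<gamma> l) k) (up (up \<beta> l) k)" using g by simp
      then show ?thesis by (simp add: b up_dn pos)
    qed
    then have 2: "midx_prec (up (up \<gamma> k) l) \<alpha>" by (simp add: up_commute[of \<gamma> k l])
    note 3 = midx_prec_trans[OF midx_prec_up 1] midx_prec_trans[OF midx_prec_up 2]
    show "D (E (gens \<gamma>)) - E (D (gens \<gamma>)) = 0"
      by (simp add: E'(3)[OF 3(1)] D'(3)[OF 3(2)] D'(3)[OF 1] E'(3)[OF 2] up_commute[of \<gamma> k l])
  qed
  \<comment> \<open>\<open>E\<close> and \<open>D\<close> raise \<beta> to the two lowered indices,
    so the commutator at \<beta> is the difference to be shown zero.\<close>
  moreover have "E (gens \<beta>) = gens (dn \<alpha> k)" "D (gens \<beta>) = gens (dn \<alpha> l)"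
    using E'(3)[of \<beta>] D'(3)[of \<beta>] midx_prec_dn[OF pos(1)] midx_prec_dn[OF pos(2)] by (simp_all add: b)
  ultimately show ?thesis by simp
qed

section \<open>Agreement of derivatives taken in different directions\<close>

definition agree :: "('m, 'n) midx \<Rightarrow> 'm \<Rightarrow> 'm \<Rightarrow> bool" where
  "agree \<alpha> k l \<longleftrightarrow> (\<forall>D E. compat gens \<alpha> k D \<longrightarrow> compat gens \<alpha> l E \<longrightarrow>
     D (gens (dn \<alpha> k)) = E (gens (dn \<alpha> l)))"

lemma agree_sym: "agree \<alpha> k l \<Longrightarrow> agree \<alpha> l k"
  unfolding agree_def by metis

text \<open>A compatible derivation in direction \<open>p\<close> supplies the common value; its
  existence keeps the two given agreements from being vacuous.\<close>

lemma agree_trans: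
  assumes "\<exists>D. compat gens \<alpha> p D" "agree \<alpha> k p" "agree \<alpha> p l"
  shows "agree \<alpha> k l"
  using assms unfolding agree_def by metis

text \<open>The two assumptions are what the later induction provides at
  \<open>(\<tau>, i)\<close>.\<close>

context
  fixes \<tau> :: "'m \<Rightarrow> nat" and i :: 'n
  assumes compat_ex: "\<And>k. \<exists>D. compat gens (\<tau>, i) k D"
    and alg: "\<And>\<beta>. midx_prec \<beta> (\<tau>, i) \<Longrightarrow> leader L \<beta> \<Longrightarrow> algebraic_over (pred_field \<beta>) (gens \<beta>)"
begin

text \<open>For one direction this is uniqueness on algebraic elements. For two, the index lowered
  in both directions is still above \<eta>, so the commutator argument applies.\<close>

lemma agree_common:
  assumes \<eta>: "leader L (\<eta>, i)" and k: "\<tau> k > 0" "\<eta> \<le> \<tau> - unit_idx k"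
    and l: "\<tau> l > 0" "\<eta> \<le> \<tau> - unit_idx l"
  shows "agree (\<tau>, i) k l"
proof (cases "k = l")
  case True
  have "leader L (dn (\<tau>, i) k)"
    using leader_upward[OF \<eta>] k(2) by (simp add: midx_le_def dn_def)
  then show ?thesis
    using compat_agree_same[of "(\<tau>, i)" k] alg[OF midx_prec_dn[of "(\<tau>, i)" k]] k(1)
    unfolding agree_def True by simp
next
  case False
  have "\<eta> x \<le> \<tau> x - unit_idx k x - unit_idx l x" for x
    using le_funD[OF k(2), of x] le_funD[OF l(2), of x] False by (simp add: unit_idx_def split: if_splits)
  then have "leader L (dn (dn (\<tau>, i) k) l)"
    using leader_upward[OF \<eta>] by (simp add: midx_le_def dn_def le_fun_def)
  moreover have "midx_prec (dn (dn (\<tau>, i) k) l) (\<tau>, i)"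
    using k(1) l(1) False
    by (intro midx_prec_trans[OF midx_prec_dn midx_prec_dn]) (simp_all add: dn_def unit_idx_def)
  ultimately show ?thesis
    unfolding agree_def using compat_agree_common[of "(\<tau>, i)" k _ l] alg k(1) l(1) False by simp
qed

text \<open>Both derivatives are compared with the one in a direction \<open>p\<close> for which \<open>\<tau> - p\<close> is above both \<open>\<eta>\<close> and \<open>\<zeta>\<close>.\<close>

lemma agree_pair:
  assumes "leader L (\<eta>, i)" "\<tau> k > 0" "\<eta> \<le> \<tau> - unit_idx k"
    and "leader L (\<zeta>, i)" "\<tau> l > 0" "\<zeta> \<le> \<tau> - unit_idx l" and ne: "sup \<eta> \<zeta> \<noteq> \<tau>"
  shows "agree (\<tau>, i) k l"
proof -
  have minus: "\<tau> - unit_idx p \<le> \<tau>" for p by (simp add: le_fun_def)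
  have "sup \<eta> \<zeta> \<le> \<tau>" using assms(3,6) minus by (meson le_sup_iff order.trans)
  then obtain p where p: "\<tau> p > 0" "sup \<eta> \<zeta> \<le> \<tau> - unit_idx p" using le_diff_unit_idx ne by metis
  then have "\<eta> \<le> \<tau> - unit_idx p" "\<zeta> \<le> \<tau> - unit_idx p" by simp_all
  then show ?thesis
    using agree_trans[OF compat_ex] agree_common[OF assms(1-3) p(1)]
      agree_sym[OF agree_common[OF assms(4-6) p(1)]] by metis
qed

lemma derivatives_agree_less:
  assumes high: "len L < mdeg \<tau>" and k: "leader_below (\<tau>, i) k" and l: "leader_below (\<tau>, i) l" and less: "k < l"
  shows "agree (\<tau>, i) k l"
proof -
  have kl: "\<tau> k > 0" "leader L (\<tau> - unit_idx k, i)" "\<tau> l > 0" "leader L (\<tau> - unit_idx l, i)"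
    using k l by (simp_all add: leader_below_def dn_def)
  obtain \<eta> where \<eta>: "minimal_leader L (\<eta>, i)" "\<eta> \<le> \<tau> - unit_idx k"
    using leader_above_minimal_leader[OF kl(2)] .
  obtain \<zeta> where \<zeta>: "minimal_leader L (\<zeta>, i)" "\<zeta> \<le> \<tau> - unit_idx l"
    using leader_above_minimal_leader[OF kl(4)] .
  have ml: "minimal_leader L \<beta> \<Longrightarrow> leader L \<beta>" for \<beta> by (simp add: minimal_leader_def)
  show ?thesis
  proof (cases "sup \<eta> \<zeta> = \<tau>")
    case False
    then show ?thesis using agree_pair[OF ml[OF \<eta>(1)] kl(1) \<eta>(2) ml[OF \<zeta>(1)] kl(3) \<zeta>(2)] by simp
  next
    case True
    \<comment> \<open>A common minimal leader would equal \<tau> and yet lie below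
      \<open>\<tau> - unit_idx k\<close>.\<close>
    have "\<eta> \<noteq> \<zeta>"
    proof
      assume "\<eta> = \<zeta>"
      then have "\<tau> \<le> \<tau> - unit_idx k" using True \<eta>(2) by simp
      from le_funD[OF this, of k] show False using kl(1) by (simp add: unit_idx_def)
    qed
    then have "(\<tau>, i) \<in> gamma_set L - Gam (len L)"
      using True \<eta>(1) \<zeta>(1) high unfolding gamma_set_def Gam_def by auto
    from chain[OF this less kl] obtain s and \<eta>s :: "nat \<Rightarrow> 'm \<Rightarrow> nat" and ks
      where s: "s \<ge> 1" "ks 1 = k" "ks s = l"
        and ch: "\<And>q. q \<in> {1..s} \<Longrightarrow> minimal_leader L (\<eta>s q, i) \<and> \<tau> (ks q) > 0 \<and> \<eta>s q \<le> \<tau> - unit_idx (ks q)"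
          "\<And>q. q \<in> {1..<s} \<Longrightarrow> mdeg (sup (\<eta>s q) (\<eta>s (Suc q))) \<le> len L"
      by (elim exE conjE) (metis (no_types))
    have "agree (\<tau>, i) k (ks q)" if "q \<in> {1..s}" for q
      using that
    proof (induction q)
      case 0
      then show ?case by simp
    next
      case (Suc q)
      show ?case
      \<comment> \<open>The chain is indexed from 1, so \<open>q = 0\<close> is the actual base
        case, where direction \<open>k\<close> is compared with itself.\<close>
      proof (cases "q = 0")
        case True
        have 1: "1 \<in> {1..s}" using s(1) by simp
        have "agree (\<tau>, i) (ks 1) (ks 1)"
          using agree_common[OF ml] ch(1)[OF 1] by blast
        then show ?thesis using True s(2) by simp
      next
        case False
        then have q: "q \<in> {1..s}" "q \<in> {1..<s}" using Suc.prems by auto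
        \<comment> \<open>The supremum has degree at most \<open>len L\<close> and \<tau> has larger
          degree, so \<open>agree_pair\<close> compares neighbouring links.\<close>
        have "sup (\<eta>s q) (\<eta>s (Suc q)) \<noteq> \<tau>" using ch(2)[OF q(2)] high by auto
        then have "agree (\<tau>, i) (ks q) (ks (Suc q))"
          using agree_pair[OF ml _ _ ml] ch(1)[OF q(1)] ch(1)[OF Suc.prems] by blast
        then show ?thesis using agree_trans[OF compat_ex Suc.IH[OF q(1)]] by simp
      qed
    qed
    from this[of s] show ?thesis using s by simp
  qed
qed

text \<open>The chain hypothesis speaks of increasing pairs of directions; symmetry and
  \<open>agree_common\<close> supply the others.\<close>

lemma derivatives_agree:
  assumes "len L < mdeg \<tau>" "leader_below (\<tau>, i) k" "leader_below (\<tau>, i) l"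
  shows "agree (\<tau>, i) k l"
proof (cases k l rule: linorder_cases)
  case less
  then show ?thesis using derivatives_agree_less assms by simp
next
  case greater
  then show ?thesis using agree_sym derivatives_agree_less assms by simp
next
  case equal
  have "leader L (\<tau> - unit_idx k, i)" "\<tau> k > 0" using assms by (simp_all add: leader_below_def dn_def)
  then show ?thesis using agree_common[of "\<tau> - unit_idx k" k k] equal by simp
qed

end


section \<open>Induction along the order of the indices\<close>

definition derivable_at :: "('m, 'n) midx \<Rightarrow> bool" where
  "derivable_at \<alpha> \<longleftrightarrow> (\<forall>k. \<exists>D. extends_base k D \<and>
     (\<forall>\<gamma>. midx_prec (up \<gamma> k) \<alpha> \<or> up \<gamma> k = \<alpha> \<longrightarrow> D (gens \<gamma>) = gens (up \<gamma> k)))"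

text \<open>The induction invariant. The equivalence makes truncations keep the leaders of
  \<open>L\<close>; the last clause says that leaders beyond its length bring in no new
  indeterminates, on which the transcendence proof relies.\<close>

definition realized_at :: "('m, 'n) midx \<Rightarrow> bool" where
  "realized_at \<alpha> \<longleftrightarrow> derivable_at \<alpha> \<and>
     (algebraic_over (pred_field \<alpha>) (gens \<alpha>) \<longleftrightarrow> leader L \<alpha>) \<and>
     (len L < mdeg (fst \<alpha>) \<longrightarrow> leader L \<alpha> \<longrightarrow> gens \<alpha> \<in> pred_field \<alpha>)"

lemma derivable_atE:
  assumes "derivable_at \<alpha>"
  obtains D where "extends_base k D"
    "\<forall>\<gamma>. midx_prec (up \<gamma> k) \<alpha> \<or> up \<gamma> k = \<alpha> \<longrightarrow> D (gens \<gamma>) = gens (up \<gamma> k)"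
  using assms unfolding derivable_at_def by blast

lemma derivable_at_low:
  assumes "mdeg (fst \<alpha>) \<le> len L"
  shows "derivable_at \<alpha>"
  unfolding derivable_at_def
proof
  fix k
  obtain D where D: "extends_base k D" "\<forall>\<gamma>. mdeg (fst \<gamma>) < len L \<longrightarrow> D (gens \<gamma>) = gens (up \<gamma> k)"
    using low_derivation[of k] by (elim exE conjE)
  have "mdeg (fst \<gamma>) < len L" if "midx_prec (up \<gamma> k) \<alpha> \<or> up \<gamma> k = \<alpha>" for \<gamma>
  proof -
    have "mdeg (fst (up \<gamma> k)) \<le> mdeg (fst \<alpha>)" by (metis midx_prec_mdeg order.refl that)
    then show ?thesis using assms by simp
  qed
  then have "\<forall>\<gamma>. midx_prec (up \<gamma> k) \<alpha> \<or> up \<gamma> k = \<alpha> \<longrightarrow> D (gens \<gamma>) = gens (up \<gamma> k)"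
    using D(2) by blast
  with D(1) show "\<exists>D. extends_base k D \<and>
     (\<forall>\<gamma>. midx_prec (up \<gamma> k) \<alpha> \<or> up \<gamma> k = \<alpha> \<longrightarrow> D (gens \<gamma>) = gens (up \<gamma> k))" by blast
qed

text \<open>The finite initial segment below \<alpha> has a greatest element \<beta>, and
  \<open>derivable_at \<beta>\<close> reaches up to \<beta> itself, which is all that
  \<open>compat\<close> at \<alpha> asks for.\<close>

lemma compat_exists:
  assumes inv: "\<And>\<beta>. midx_prec \<beta> \<alpha> \<Longrightarrow> derivable_at \<beta>" and high: "len L < mdeg (fst \<alpha>)"
  shows "\<exists>D. compat gens \<alpha> k D"
proof -
  \<comment> \<open>The zero tuple shows that the initial segment is nonempty, because \<alpha> has
    positive degree.\<close>
  have "midx_prec (\<lambda>_. 0, snd \<alpha>) \<alpha>" unfolding midx_prec_def using high by (simp add: mdeg_def)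
  then have "{\<beta>. midx_prec \<beta> \<alpha>} \<noteq> {}" by blast
  from finite_midx_has_max[OF finite_midx_prec this] obtain \<beta>
    where b: "midx_prec \<beta> \<alpha>" "\<forall>\<gamma>\<in>{\<beta>. midx_prec \<beta> \<alpha>}. midx_prec \<gamma> \<beta> \<or> \<gamma> = \<beta>" by blast
  obtain D where D: "extends_base k D"
    "\<forall>\<gamma>. midx_prec (up \<gamma> k) \<beta> \<or> up \<gamma> k = \<beta> \<longrightarrow> D (gens \<gamma>) = gens (up \<gamma> k)"
    using derivable_atE[OF inv[OF b(1)]] .
  then have "compat gens \<alpha> k D" unfolding compat_def using b(2) by blast
  then show ?thesis by blast
qed

text \<open>Up to degree \<open>len L\<close> everything is an image under \<open>rconst\<close>,
  which preserves and reflects algebraicity.\<close>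

lemma algebraic_pred_field_low:
  assumes low: "mdeg (fst \<alpha>) \<le> len L"
  shows "algebraic_over (pred_field \<alpha>) (gens \<alpha>) \<longleftrightarrow>
    algebraic_over (adjoin (base L) (gen L) {\<beta>. midx_prec \<beta> \<alpha>}) (gen L \<alpha>)"
proof -
  have "pred_field \<alpha> = adjoin (\<lambda>c. rconst (base L c)) (\<lambda>\<beta>. rconst (gen L \<beta>)) {\<beta>. midx_prec \<beta> \<alpha>}"
    unfolding pred_field_def base_map_def[abs_def]
    by (rule adjoin_cong) (use low midx_prec_mdeg order.trans gens_low in blast)
  also have "\<dots> = rconst ` adjoin (base L) (gen L) {\<beta>. midx_prec \<beta> \<alpha>}"
    by (rule adjoin_image[OF field_hom_rconst, symmetric])
  finally show ?thesis
    by (simp only: gens_low[OF low] algebraic_over_image[OF field_hom_rconst is_subfield_adjoin])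
qed

text \<open>Leaders are closed upwards by definition, so algebraicity may be known only at a lower
  \<eta>. Then the generator at \<alpha> is the derivative of an algebraic one a step down and lies
  in \<open>pred_field \<alpha>\<close>.\<close>

lemma algebraic_low_iff:
  assumes IH: "\<And>\<beta>. midx_prec \<beta> \<alpha> \<Longrightarrow> realized_at \<beta>" and low: "mdeg (fst \<alpha>) \<le> len L"
  shows "algebraic_over (pred_field \<alpha>) (gens \<alpha>) \<longleftrightarrow> leader L \<alpha>"
proof
  assume "algebraic_over (pred_field \<alpha>) (gens \<alpha>)"
  then show "leader L \<alpha>"
    unfolding leader_def algebraic_pred_field_low[OF low]
    by (intro exI[of _ "fst \<alpha>"]) (use low in simp)
next
  assume "leader L \<alpha>"
  then obtain \<eta> where \<eta>: "\<eta> \<le> fst \<alpha>" "mdeg \<eta> \<le> len L"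
    "algebraic_over (adjoin (base L) (gen L) {\<beta>. midx_prec \<beta> (\<eta>, snd \<alpha>)}) (gen L (\<eta>, snd \<alpha>))"
    unfolding leader_def by (elim exE conjE)
  show "algebraic_over (pred_field \<alpha>) (gens \<alpha>)"
  proof (cases "\<eta> = fst \<alpha>")
    case True
    then show ?thesis using \<eta>(3) algebraic_pred_field_low[OF low] by simp
  next
    case False
    then obtain k where k: "fst \<alpha> k > 0" "\<eta> \<le> fst \<alpha> - unit_idx k"
      using le_diff_unit_idx[OF \<eta>(1)] by metis
    have ld: "leader L (dn \<alpha> k)"
      unfolding leader_def using \<eta>(2,3) k(2) by (intro exI[of _ \<eta>]) (simp add: dn_def)
    obtain D where D: "extends_base k D"
      "\<forall>\<gamma>. midx_prec (up \<gamma> k) \<alpha> \<or> up \<gamma> k = \<alpha> \<longrightarrow> D (gens \<gamma>) = gens (up \<gamma> k)"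
      using derivable_atE[OF derivable_at_low[OF low]] .
    have "compat gens \<alpha> k D" unfolding compat_def using D by blast
    moreover have "leader_below \<alpha> k" using k(1) ld by (simp add: leader_below_def)
    moreover have "algebraic_over (pred_field (dn \<alpha> k)) (gens (dn \<alpha> k))"
      using IH[OF midx_prec_dn[OF k(1)]] ld unfolding realized_at_def by blast
    ultimately have "D (gens (dn \<alpha> k)) \<in> pred_field \<alpha>" by (rule compat_pred_field)
    moreover have "D (gens (dn \<alpha> k)) = gens \<alpha>" using D(2) up_dn[OF k(1)] by metis
    ultimately show ?thesis by (simp add: algebraic_over_mem[OF is_subfield_pred_field])
  qed
qed

text \<open>The Euler operator of the variable \<open>gens \<alpha>\<close> kills \<open>pred_field \<alpha>\<close> but not \<open>gens \<alpha>\<close>.\<close>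

lemma free_transcendental:
  assumes IH: "\<And>\<beta>. midx_prec \<beta> \<alpha> \<Longrightarrow> realized_at \<beta>" and high: "len L < mdeg (fst \<alpha>)"
    and free: "\<not> leader L \<alpha>"
  shows "\<not> algebraic_over (pred_field \<alpha>) (gens \<alpha>)"
proof
  assume alg: "algebraic_over (pred_field \<alpha>) (gens \<alpha>)"
  obtain E :: "'a ratfun \<Rightarrow> 'a ratfun" where E: "derivation E" "\<And>c. E (rconst c) = 0"
    "\<And>k. k \<noteq> to_nat \<alpha> \<Longrightarrow> E (rvar k) = 0" "E (rvar (to_nat \<alpha>)) \<noteq> 0"
    using rvar_derivation by metis
  have zero: "derivation (\<lambda>x. 0 :: 'a ratfun)" unfolding derivation_def derivation_on_def by simp
  have E0: "E (gens \<gamma>) = 0" if "midx_prec \<gamma> \<alpha>" for \<gamma>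
    using that
  proof (induction \<gamma> rule: midx_prec_induct)
    case (less \<gamma>)
    show ?case
    proof (cases "mdeg (fst \<gamma>) \<le> len L")
      case True
      then show ?thesis by (simp add: gens_low E(2))
    next
      case False
      then have h: "len L < mdeg (fst \<gamma>)" by simp
      show ?thesis
      proof (cases "leader L \<gamma>")
        case True
        then have "gens \<gamma> \<in> pred_field \<gamma>" using IH[OF less.prems] h unfolding realized_at_def by blast
        then show ?thesis unfolding pred_field_def
        proof (rule derivations_agree_adjoin[OF E(1) zero, rotated -1])
          show "E (base_map c) = 0" for c by (simp add: base_map_def E(2))
          show "E (gens \<beta>) = 0" if "\<beta> \<in> {\<beta>. midx_prec \<beta> \<gamma>}" for \<beta>
            using less.IH[of \<beta>] midx_prec_trans[OF _ less.prems] that by simp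
        qed
      next
        case False
        have "to_nat \<gamma> \<noteq> to_nat \<alpha>" using less.prems by auto
        then show ?thesis using gens_free[OF h False] E(3) by simp
      qed
    qed
  qed
  have "E (gens \<alpha>) = 0"
    by (rule derivations_agree_pred_field[OF E(1) zero _ E0 alg]) (simp_all add: base_map_def E(2))
  then show False using E(4) gens_free[OF high free] by simp
qed

lemma leader_high:
  assumes IH: "\<And>\<beta>. midx_prec \<beta> \<alpha> \<Longrightarrow> realized_at \<beta>" and high: "len L < mdeg (fst \<alpha>)"
    and ld: "leader L \<alpha>"
  shows "gens \<alpha> \<in> pred_field \<alpha>"
proof -
  have "\<exists>D. compat gens \<alpha> k D" for k
    by (rule compat_exists[OF _ high]) (use IH in \<open>simp add: realized_at_def\<close>)
  from gens_leader[OF high ld this] obtain k D where k: "leader_below \<alpha> k" "compat gens \<alpha> k D"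
    "gens \<alpha> = D (gens (dn \<alpha> k))" by metis
  have "algebraic_over (pred_field (dn \<alpha> k)) (gens (dn \<alpha> k))"
    using IH[OF midx_prec_dn] k(1) unfolding realized_at_def leader_below_def by blast
  then show ?thesis unfolding k(3) by (rule compat_pred_field[OF k(2,1)])
qed

text \<open>Beyond compatibility, only \<open>D (gens (dn \<alpha> k)) = gens \<alpha>\<close> is
  new. It follows from the agreement of derivatives if \<open>dn \<alpha> k\<close> is a leader, can
  be prescribed if it is not, and is void if \<alpha> has entry 0 at \<open>k\<close>.\<close>

lemma derivable_at_high:
  assumes IH: "\<And>\<beta>. midx_prec \<beta> \<alpha> \<Longrightarrow> realized_at \<beta>" and high: "len L < mdeg (fst \<alpha>)"
  shows "derivable_at \<alpha>"
  unfolding derivable_at_def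
proof
  fix k
  have ex: "\<exists>D. compat gens \<alpha> k D" for k
    by (rule compat_exists[OF _ high]) (use IH in \<open>simp add: realized_at_def\<close>)
  obtain D where D: "compat gens \<alpha> k D" using ex by blast
  have "\<exists>D'. compat gens \<alpha> k D' \<and> (fst \<alpha> k > 0 \<longrightarrow> D' (gens (dn \<alpha> k)) = gens \<alpha>)"
  proof (cases "leader_below \<alpha> k")
    case True
    have "leader L \<alpha>" using True high_leader_iff[OF high] by blast
    from gens_leader[OF high this ex] obtain l E where l: "leader_below \<alpha> l" "compat gens \<alpha> l E"
      "gens \<alpha> = E (gens (dn \<alpha> l))" by metis
    have "agree (fst \<alpha>, snd \<alpha>) k l"
    proof (rule derivatives_agree)
      show "\<exists>D. compat gens (fst \<alpha>, snd \<alpha>) k D" for k using ex by simp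
      show "algebraic_over (pred_field \<beta>) (gens \<beta>)" if "midx_prec \<beta> (fst \<alpha>, snd \<alpha>)" "leader L \<beta>" for \<beta>
        using IH[of \<beta>] that unfolding realized_at_def by simp
    qed (use high True l(1) in simp_all)
    then have "agree \<alpha> k l" by (simp only: prod.collapse)
    then have "D (gens (dn \<alpha> k)) = E (gens (dn \<alpha> l))"
      using D l(2) unfolding agree_def by blast
    then show ?thesis using D l(3) by (intro exI[of _ D]) simp
  next
    case False
    show ?thesis
    proof (cases "fst \<alpha> k > 0")
      case True
      then have "\<not> leader L (dn \<alpha> k)" using False by (simp add: leader_below_def)
      then have tr: "\<not> algebraic_over (pred_field (dn \<alpha> k)) (gens (dn \<alpha> k))"
        using IH[OF midx_prec_dn[OF True]] unfolding realized_at_def by blast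
      have "derivation_on (pred_field (dn \<alpha> k)) D"
        using compatD(1)[OF D] unfolding derivation_def derivation_on_def by simp
      \<comment> \<open>The value at the transcendental generator is reset to
        \<open>gens \<alpha>\<close>; compatibility survives, since it concerns only generators
        preceding \<open>dn \<alpha> k\<close>.\<close>
      from derivation_extend_transcendental[OF this is_subfield_pred_field tr]
      obtain D' where D': "derivation D'" "\<And>z. z \<in> pred_field (dn \<alpha> k) \<Longrightarrow> D' z = D z"
        "D' (gens (dn \<alpha> k)) = gens \<alpha>" by metis
      have "D' (base_map c) = base_map (\<delta> k c)" for c using D'(2)[OF base_map_pred_field] compatD(2)[OF D] by simp
      moreover have "D' (gens \<gamma>) = gens (up \<gamma> k)" if "midx_prec (up \<gamma> k) \<alpha>" for \<gamma>
      proof -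
        have "midx_prec \<gamma> (dn \<alpha> k)"
          using that midx_prec_up_up[of \<gamma> k "dn \<alpha> k"] up_dn[OF True] by simp
        then show ?thesis using D'(2)[OF gens_pred_field] compatD(3)[OF D that] by simp
      qed
      ultimately have "compat gens \<alpha> k D'"
        unfolding compat_def extends_base_def using D'(1) by (intro conjI allI impI)
      then show ?thesis using D'(3) by (intro exI[of _ D']) simp
    next
      case False
      then show ?thesis using D by (intro exI[of _ D]) simp
    qed
  qed
  then obtain D' where D': "compat gens \<alpha> k D'" "fst \<alpha> k > 0 \<longrightarrow> D' (gens (dn \<alpha> k)) = gens \<alpha>"
    by (elim exE conjE)
  have "D' (gens \<gamma>) = gens (up \<gamma> k)" if "midx_prec (up \<gamma> k) \<alpha> \<or> up \<gamma> k = \<alpha>" for \<gamma>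
    using that
  proof
    assume "midx_prec (up \<gamma> k) \<alpha>"
    then show ?thesis by (rule compatD(3)[OF D'(1)])
  next
    assume "up \<gamma> k = \<alpha>"
    then show ?thesis using D'(2) up_pos[of \<gamma> k] dn_up[of \<gamma> k] by simp
  qed
  moreover have "extends_base k D'" using D'(1) by (simp only: compat_def)
  ultimately show "\<exists>D. extends_base k D \<and>
      (\<forall>\<gamma>. midx_prec (up \<gamma> k) \<alpha> \<or> up \<gamma> k = \<alpha> \<longrightarrow> D (gens \<gamma>) = gens (up \<gamma> k))"
    by (intro exI[of _ D'] conjI allI impI)
qed

lemma realized_at: "realized_at \<alpha>"
proof (induction \<alpha> rule: midx_prec_induct)
  case (less \<alpha>)
  show ?case
  proof (cases "mdeg (fst \<alpha>) \<le> len L")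
    case True
    then show ?thesis unfolding realized_at_def
      using derivable_at_low[OF True] algebraic_low_iff[OF less True] by simp
  next
    case False
    then have h: "len L < mdeg (fst \<alpha>)" by simp
    have "algebraic_over (pred_field \<alpha>) (gens \<alpha>) \<longleftrightarrow> leader L \<alpha>"
      using free_transcendental[OF less h] leader_high[OF less h]
        algebraic_over_mem[OF is_subfield_pred_field] by blast
    then show ?thesis unfolding realized_at_def
      using derivable_at_high[OF less h] leader_high[OF less h] by simp
  qed
qed

lemma algebraic_iff_leader: "algebraic_over (pred_field \<alpha>) (gens \<alpha>) \<longleftrightarrow> leader L \<alpha>"
  using realized_at unfolding realized_at_def by blast

text \<open>The derivation chosen for \<alpha> is determined by the generators on the field
  \<open>F \<alpha>\<close>. These restrictions therefore form a chain, whose union is a graph and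
  extends to the whole field.\<close>

lemma global_derivation: "\<exists>D. extends_base k D \<and> (\<forall>\<gamma>. D (gens \<gamma>) = gens (up \<gamma> k))"
proof -
  define S :: "('m, 'n) midx \<Rightarrow> ('m, 'n) midx set" where "S \<alpha> = {\<gamma>. midx_prec (up \<gamma> k) \<alpha> \<or> up \<gamma> k = \<alpha>}" for \<alpha>
  have "\<forall>\<alpha>. \<exists>D. extends_base k D \<and> (\<forall>\<gamma>\<in>S \<alpha>. D (gens \<gamma>) = gens (up \<gamma> k))"
    using realized_at unfolding realized_at_def derivable_at_def S_def by blast
  from choice[OF this] obtain D
    where D: "\<forall>\<alpha>. extends_base k (D \<alpha>) \<and> (\<forall>\<gamma>\<in>S \<alpha>. D \<alpha> (gens \<gamma>) = gens (up \<gamma> k))" ..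
  define F where "F \<alpha> = adjoin base_map gens (S \<alpha>)" for \<alpha>
  have der: "derivation (D \<alpha>)" "D \<alpha> (base_map c) = base_map (\<delta> k c)"
    "\<gamma> \<in> S \<alpha> \<Longrightarrow> D \<alpha> (gens \<gamma>) = gens (up \<gamma> k)" for \<alpha> c \<gamma>
    using D unfolding extends_base_def by blast+
  have F: "is_subfield (F \<alpha>)" for \<alpha> unfolding F_def by (rule is_subfield_adjoin)
  have mono: "x \<in> F \<beta> \<and> D \<beta> x = D \<alpha> x" if "x \<in> F \<alpha>" "midx_prec \<alpha> \<beta> \<or> \<alpha> = \<beta>" for x \<alpha> \<beta>
  proof -
    have S: "S \<alpha> \<subseteq> S \<beta>" using that(2) midx_prec_trans unfolding S_def by blast
    have "x \<in> F \<beta>" using that(1) unfolding F_def by (rule subsetD[OF adjoin_mono[OF S]])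
    moreover have "D \<beta> x = D \<alpha> x"
      by (rule derivations_agree_adjoin[OF der(1) der(1) _ _ that(1)[unfolded F_def]])
        (use der(2,3) subsetD[OF S] in simp_all)
    ultimately show ?thesis by simp
  qed
  define H where "H = {z. \<exists>\<alpha>. fst z \<in> F \<alpha> \<and> snd z = D \<alpha> (fst z)}"
  have H: "(x, x') \<in> H \<longleftrightarrow> (\<exists>\<alpha>. x \<in> F \<alpha> \<and> x' = D \<alpha> x)" for x x' by (simp add: H_def)
  have "der_graph H"
    unfolding der_graph_def
  proof (intro conjI allI impI)
    \<comment> \<open>Any index serves as witness, since 1 lies in every
      \<open>F \<alpha>\<close>.\<close>
    show "(1, 0) \<in> H" unfolding H
      by (rule exI[of _ undefined]) (simp add: is_subfieldD(2)[OF F] derivationD(4)[OF der(1)])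
    show "z = 0" if "(0, z) \<in> H" for z
      using that unfolding H by (elim exE conjE) (simp add: derivationD(3)[OF der(1)])
  next
    fix a a' b b' assume "(a, a') \<in> H" "(b, b') \<in> H"
    then obtain \<alpha> \<beta> where a: "a \<in> F \<alpha>" "a' = D \<alpha> a" and b: "b \<in> F \<beta>" "b' = D \<beta> b"
      unfolding H by (elim exE conjE)
    have "\<exists>\<mu>. (midx_prec \<alpha> \<mu> \<or> \<alpha> = \<mu>) \<and> (midx_prec \<beta> \<mu> \<or> \<beta> = \<mu>)"
      using midx_prec_total[of \<alpha> \<beta>] by blast
    then obtain \<mu> where \<mu>: "midx_prec \<alpha> \<mu> \<or> \<alpha> = \<mu>" "midx_prec \<beta> \<mu> \<or> \<beta> = \<mu>" by (elim exE conjE)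
    have ab: "a \<in> F \<mu>" "a' = D \<mu> a" "b \<in> F \<mu>" "b' = D \<mu> b"
      using mono[OF a(1) \<mu>(1)] mono[OF b(1) \<mu>(2)] a(2) b(2) by simp_all
    show "(a - b, a' - b') \<in> H" unfolding H
      by (rule exI[of _ \<mu>]) (simp add: ab is_subfieldD(7)[OF F] derivationD(6)[OF der(1)])
    show "(a * b, a' * b + a * b') \<in> H" unfolding H
      by (rule exI[of _ \<mu>]) (simp add: ab is_subfieldD(4)[OF F] derivationD(2)[OF der(1)])
  qed
  from der_graph_total[OF this] obtain E
    where E: "derivation_on UNIV E" "\<forall>a a'. (a, a') \<in> H \<longrightarrow> E a = a'" by (elim exE conjE)
  have E': "E x = D \<alpha> x" if "x \<in> F \<alpha>" for x \<alpha>
    using E(2)[rule_format, of x "D \<alpha> x"] H that by blast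
  have "E (base_map c) = base_map (\<delta> k c)" for c
    using E'[of "base_map c" undefined] der(2)[of undefined c] unfolding F_def by (simp add: adjoin_base)
  moreover have "E (gens \<gamma>) = gens (up \<gamma> k)" for \<gamma>
  proof -
    have S: "\<gamma> \<in> S (up \<gamma> k)" by (simp add: S_def)
    then have "gens \<gamma> \<in> F (up \<gamma> k)" unfolding F_def by (rule adjoin_gen)
    then show ?thesis using E' der(3)[OF S] by simp
  qed
  ultimately show ?thesis using E(1) unfolding extends_base_def derivation_def by blast
qed

section \<open>The differential field generated by the generators\<close>

definition gens_der :: "'m \<Rightarrow> 'a ratfun \<Rightarrow> 'a ratfun" where
  "gens_der k = (SOME D. extends_base k D \<and> (\<forall>\<gamma>. D (gens \<gamma>) = gens (up \<gamma> k)))"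

lemma gens_der: "derivation (gens_der k)" "gens_der k (base_map c) = base_map (\<delta> k c)" "gens_der k (gens \<gamma>) = gens (up \<gamma> k)"
proof -
  have "extends_base k (gens_der k) \<and> (\<forall>\<gamma>. gens_der k (gens \<gamma>) = gens (up \<gamma> k))"
    unfolding gens_der_def by (rule someI_ex[OF global_derivation])
  then show "derivation (gens_der k)" "gens_der k (base_map c) = base_map (\<delta> k c)" "gens_der k (gens \<gamma>) = gens (up \<gamma> k)"
    unfolding extends_base_def by blast+
qed

lemma derivation_on_gens_der: "derivation_on F (gens_der k)"
  using gens_der(1)[of k] unfolding derivation_def derivation_on_def by simp

lemma field_hom_base_map: "field_hom_on UNIV base_map"
proof -
  have "field_hom_on UNIV (base L)" using differential_kernel by (simp add: differential_kernel_def)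
  then show ?thesis
    unfolding field_hom_on_def base_map_def by (simp add: field_hom_onD[OF field_hom_rconst])
qed

definition gens_field :: "'a ratfun set" where
  "gens_field = adjoin base_map gens UNIV"

text \<open>Commutators vanish on the base field and on the generators, hence on
  \<open>gens_field\<close>. The extensions beyond it were chosen arbitrarily, which is why this
  subfield carries the realization.\<close>

lemma differential_extension_gens_field: "differential_extension \<delta> base_map gens_field gens_der"
proof -
  have M: "is_subfield gens_field" unfolding gens_field_def by (rule is_subfield_adjoin)
  have b: "base_map c \<in> gens_field" for c unfolding gens_field_def by (rule adjoin_base)
  have g: "gens \<gamma> \<in> gens_field" for \<gamma> unfolding gens_field_def by (rule adjoin_gen) simp
  have cl: "gens_der k x \<in> gens_field" if "x \<in> gens_field" for k x
    by (rule derivation_adjoin_mem[OF gens_der(1) M _ _ _ _ that[unfolded gens_field_def]]) (simp_all add: b g gens_der)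
  have zero: "derivation (\<lambda>x. 0 :: 'a ratfun)" unfolding derivation_def derivation_on_def by simp
  have \<delta>: "\<delta> k (\<delta> l c) = \<delta> l (\<delta> k c)" for k l c
    using differential_field unfolding differential_field_def by simp
  have "gens_der k (gens_der l x) - gens_der l (gens_der k x) = 0" if "x \<in> gens_field" for k l x
    by (rule derivations_agree_adjoin[OF derivation_commutator[OF gens_der(1) gens_der(1)] zero _ _ that[unfolded gens_field_def]])
      (simp_all add: gens_der \<delta>[of k l] up_commute[of _ k l])
  then show ?thesis
    unfolding differential_extension_def differential_field_def
    using M b cl field_hom_base_map by (auto simp: gens_der(2) derivation_on_gens_der)
qed

lemma iterate_gens_der: "(gens_der k ^^ p) (gens (\<xi>, i)) = gens (\<xi> + (\<lambda>l. if l = k then p else 0), i)"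
proof (induction p)
  case 0
  have "\<xi> + (\<lambda>l. if l = k then 0 else 0) = \<xi>" by (rule ext) simp
  then show ?case by simp
next
  case (Suc p)
  have "\<xi> + (\<lambda>l. if l = k then p else 0) + unit_idx k = \<xi> + (\<lambda>l. if l = k then Suc p else 0)"
    by (rule ext) (simp add: unit_idx_def)
  then have "gens_der k (gens (\<xi> + (\<lambda>l. if l = k then p else 0), i)) = gens (\<xi> + (\<lambda>l. if l = k then Suc p else 0), i)"
    by (simp only: gens_der(3) up_def fst_conv snd_conv)
  then show ?case by (simp only: funpow.simps comp_apply Suc)
qed

lemma iter_der_gens_der: "iter_der gens_der \<xi> (gens (0, i)) = gens (\<xi>, i)"
proof -
  \<comment> \<open>Generalized to lists of distinct directions, with entry 0 at the directions
    outside the list.\<close>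
  have "foldr (\<lambda>k. gens_der k ^^ \<xi> k) ks (gens (0, i)) = gens (\<lambda>k. if k \<in> set ks then \<xi> k else 0, i)"
    if "distinct ks" for ks
    using that
  proof (induction ks)
    case Nil
    then show ?case by (simp add: zero_fun_def)
  next
    case (Cons k ks)
    have "(\<lambda>l. if l \<in> set ks then \<xi> l else 0) + (\<lambda>l. if l = k then \<xi> k else 0)
        = (\<lambda>l. if l \<in> set (k # ks) then \<xi> l else 0)"
      using Cons.prems by (intro ext) auto
    then show ?case using Cons by (simp add: iterate_gens_der)
  qed
  from this[of "sorted_list_of_set UNIV"] show ?thesis unfolding iter_der_def by simp
qed

lemma iter_der_gens: "(\<lambda>(\<xi>, i). iter_der gens_der \<xi> (gens (0, i))) = gens"
  by (rule ext) (simp add: iter_der_gens_der case_prod_beta)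

section \<open>Truncations as generic prolongations\<close>

definition truncation :: "nat \<Rightarrow> ('k, 'm, 'n, 'a ratfun) kernel" where
  "truncation s = \<lparr>len = s, base = base_map, gen = gens, der = gens_der\<rparr>"

lemma truncation_simps [simp]: "len (truncation s) = s" "base (truncation s) = base_map" "gen (truncation s) = gens" "der (truncation s) = gens_der"
  by (simp_all add: truncation_def)

lemma kernel_field_truncation: "kernel_field (truncation s) = adjoin base_map gens (Gam s)"
  by (simp add: kernel_field_def)

lemma differential_kernel_truncation: "differential_kernel \<delta> (truncation s)"
proof -
  have "gens_der k x \<in> kernel_field (truncation s)" if "x \<in> kernel_dom (truncation s)" for k x
    unfolding kernel_field_truncation
  proof (rule derivation_adjoin_mem[OF gens_der(1) is_subfield_adjoin])
    show "x \<in> adjoin base_map gens (Gam_below s)" using that by (simp add: kernel_dom_def)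
    show "base_map c \<in> adjoin base_map gens (Gam s)" "gens_der k (base_map c) \<in> adjoin base_map gens (Gam s)" for c
      unfolding gens_der(2) by (rule adjoin_base)+
    fix \<gamma> :: "('m, 'n) midx" assume "\<gamma> \<in> Gam_below s"
    then have "\<gamma> \<in> Gam s" "up \<gamma> k \<in> Gam s" unfolding Gam_below_def Gam_def by simp_all
    then show "gens \<gamma> \<in> adjoin base_map gens (Gam s)" "gens_der k (gens \<gamma>) \<in> adjoin base_map gens (Gam s)"
      unfolding gens_der(3) by (simp_all add: adjoin_gen)
  qed
  then have "gens_der k ` kernel_dom (truncation s) \<subseteq> kernel_field (truncation s)" for k by blast
  moreover have "\<forall>(\<xi>, i)\<in>Gam_below s. gens_der k (gens (\<xi>, i)) = gens (\<xi> + unit_idx k, i)" for k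
    by (simp add: gens_der(3) up_def)
  ultimately show ?thesis
    unfolding differential_kernel_def truncation_simps
    using field_hom_base_map derivation_on_gens_der gens_der(2) by (intro conjI allI)
qed

text \<open>By \<open>algebraic_iff_leader\<close> the algebraicity tests in a truncation decide
  leadership for \<open>L\<close> in every degree; conversely, the witness of a leader of
  \<open>L\<close> has degree at most \<open>len L\<close>, hence at most \<open>s\<close>.\<close>

lemma leader_truncation:
  assumes "len L \<le> s"
  shows "leader (truncation s) \<alpha> \<longleftrightarrow> leader L \<alpha>"
proof -
  have "leader (truncation s) \<alpha> \<longleftrightarrow> (\<exists>\<eta>\<le>fst \<alpha>. mdeg \<eta> \<le> s \<and> leader L (\<eta>, snd \<alpha>))"
    unfolding leader_def[of "truncation s"] truncation_simps pred_field_def[symmetric] algebraic_iff_leader ..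
  also have "\<dots> \<longleftrightarrow> leader L \<alpha>"
  proof
    assume "\<exists>\<eta>\<le>fst \<alpha>. mdeg \<eta> \<le> s \<and> leader L (\<eta>, snd \<alpha>)"
    then obtain \<eta> where \<eta>: "\<eta> \<le> fst \<alpha>" "leader L (\<eta>, snd \<alpha>)" by (elim exE conjE)
    show "leader L \<alpha>" by (rule leader_upward[OF \<eta>(2)]) (simp add: midx_le_def \<eta>(1))
  next
    assume "leader L \<alpha>"
    then obtain \<eta> where \<eta>: "\<eta> \<le> fst \<alpha>" "mdeg \<eta> \<le> len L"
      "algebraic_over (adjoin (base L) (gen L) {\<beta>. midx_prec \<beta> (\<eta>, snd \<alpha>)}) (gen L (\<eta>, snd \<alpha>))"
      unfolding leader_def by (elim exE conjE)
    then have "leader L (\<eta>, snd \<alpha>)" unfolding leader_def by (intro exI[of _ \<eta>]) simp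
    then show "\<exists>\<eta>\<le>fst \<alpha>. mdeg \<eta> \<le> s \<and> leader L (\<eta>, snd \<alpha>)"
      using \<eta>(1,2) assms by (intro exI[of _ \<eta>]) simp
  qed
  finally show ?thesis .
qed

lemma rconst_kernel:
  "rconst ` adjoin (base L) (gen L) A = adjoin base_map gens A" if "A \<subseteq> Gam (len L)"
  unfolding adjoin_image[OF field_hom_rconst] base_map_def[abs_def]
  by (rule adjoin_cong) (use that in \<open>auto simp: gens_low Gam_def subset_iff\<close>)

lemma rconst_kernel_field: "rconst ` kernel_field L = adjoin base_map gens (Gam (len L))"
  unfolding kernel_field_def by (rule rconst_kernel) simp

text \<open>\<open>gens_der k\<close> and the derivation transported from \<open>L\<close> are
  chosen separately; they agree on the base field and on the generators of
  \<open>kernel_dom L\<close>, hence on its image.\<close>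

lemma rconst_der:
  assumes "x \<in> kernel_dom L"
  shows "gens_der k (rconst x) = rconst (der L k x)"
proof -
  have F: "is_subfield (kernel_dom L)" unfolding kernel_dom_def by (rule is_subfield_adjoin)
  have d: "derivation_on (kernel_dom L) (der L k)" "der L k (base L c) = base L (\<delta> k c)"
    "\<forall>(\<xi>, i) \<in> Gam_below (len L). der L k (gen L (\<xi>, i)) = gen L (\<xi> + unit_idx k, i)" for c
    using differential_kernel unfolding differential_kernel_def by simp_all
  obtain D where D: "derivation D" "\<And>x. x \<in> kernel_dom L \<Longrightarrow> D (rconst x) = rconst (der L k x)"
    using derivation_transfer[OF field_hom_rconst F d(1)] by metis
  have sub: "Gam_below (len L) \<subseteq> Gam (len L)" by (auto simp: Gam_def Gam_below_def)
  have "rconst x \<in> adjoin base_map gens (Gam_below (len L))"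
    using assms unfolding kernel_dom_def rconst_kernel[OF sub, symmetric] by (rule imageI)
  then have "gens_der k (rconst x) = D (rconst x)"
  proof (rule derivations_agree_adjoin[OF gens_der(1) D(1), rotated -1])
    show "gens_der k (base_map c) = D (base_map c)" for c
      using D(2)[unfolded kernel_dom_def, OF adjoin_base] d(2) gens_der(2)[of k c] by (simp add: base_map_def)
    fix \<gamma> :: "('m, 'n) midx" assume g: "\<gamma> \<in> Gam_below (len L)"
    then have low: "mdeg (fst \<gamma>) < len L" by (simp add: Gam_below_def)
    have "gen L \<gamma> \<in> kernel_dom L" using g unfolding kernel_dom_def by (rule adjoin_gen)
    moreover have "der L k (gen L \<gamma>) = gen L (up \<gamma> k)"
      using bspec[OF d(3) g] by (simp add: up_def case_prod_beta)
    ultimately show "gens_der k (gens \<gamma>) = D (gens \<gamma>)"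
      unfolding gens_der(3) using low D(2) by (simp add: gens_low)
  qed
  then show ?thesis using D(2)[OF assms] by simp
qed

lemma generic_prolongation_start:
  assumes "len L \<le> s"
  shows "generic_prolongation \<delta> L (truncation s)"
proof -
  have "Gam (len L) \<subseteq> (Gam s :: ('m, 'n) midx set)" using assms by (auto simp: Gam_def)
  then have "rconst ` kernel_field L \<subseteq> kernel_field (truncation s)"
    unfolding rconst_kernel_field kernel_field_truncation by (rule adjoin_mono)
  moreover have "field_hom_on (kernel_field L) rconst"
    unfolding field_hom_on_def by (simp add: field_hom_onD[OF field_hom_rconst])
  moreover have "\<forall>\<alpha>\<in>Gam (len L). rconst (gen L \<alpha>) = gens \<alpha>"
    unfolding Gam_def by (intro ballI gens_low[symmetric]) simp
  ultimately have "prolongation \<delta> L (truncation s)"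
    unfolding prolongation_def truncation_simps
    using differential_kernel differential_kernel_truncation assms rconst_der base_map_def
    by (intro conjI exI[of _ rconst]) simp_all
  then show ?thesis
    unfolding generic_prolongation_def
    by (rule conjI) (rule minimal_leaders_cong[OF leader_truncation[OF assms, symmetric]])
qed

lemma generic_prolongation_truncation:
  assumes "len L \<le> s" "s \<le> t"
  shows "generic_prolongation \<delta> (truncation s) (truncation t)"
proof -
  have "Gam s \<subseteq> (Gam t :: ('m, 'n) midx set)" using assms by (auto simp: Gam_def)
  then have "id ` kernel_field (truncation s) \<subseteq> kernel_field (truncation t)"
    unfolding kernel_field_truncation image_id id_apply by (rule adjoin_mono)
  moreover have "field_hom_on (kernel_field (truncation s)) id" unfolding field_hom_on_def by simp
  ultimately have "prolongation \<delta> (truncation s) (truncation t)"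
    unfolding prolongation_def using differential_kernel_truncation assms(2)
    by (intro conjI exI[of _ id]) simp_all
  moreover have "{\<alpha>. minimal_leader (truncation s) \<alpha>} = {\<alpha>. minimal_leader (truncation t) \<alpha>}"
    using leader_truncation[OF assms(1)] leader_truncation[of t] assms by (intro minimal_leaders_cong) simp
  ultimately show ?thesis unfolding generic_prolongation_def by (rule conjI)
qed

lemma range_gens: "range (\<lambda>i. gens (0, i)) \<subseteq> gens_field"
  unfolding gens_field_def by (auto intro: adjoin_gen)

lemma regular_realization_start: "regular_realization \<delta> L base_map gens_field gens_der (\<lambda>i. gens (0, i))"
proof -
  have "field_hom_on (kernel_field L) rconst"
    unfolding field_hom_on_def by (simp add: field_hom_onD[OF field_hom_rconst])
  moreover have "bij_betw rconst (kernel_field L) (adjoin base_map gens (Gam (len L)))"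
    unfolding bij_betw_def rconst_kernel_field
    using inj_on_subset[OF field_hom_onD(8)[OF field_hom_rconst]] by simp
  moreover have "\<forall>(\<xi>, i)\<in>Gam (len L). rconst (gen L (\<xi>, i)) = iter_der gens_der \<xi> (gens (0, i))"
    by (auto simp: Gam_def gens_low iter_der_gens_der)
  ultimately show ?thesis
    unfolding regular_realization_def iter_der_gens
    using differential_extension_gens_field range_gens base_map_def by (intro conjI exI[of _ rconst]) simp_all
qed

lemma regular_realization_truncation: "regular_realization \<delta> (truncation s) base_map gens_field gens_der (\<lambda>i. gens (0, i))"
proof -
  have "field_hom_on (kernel_field (truncation s)) id" unfolding field_hom_on_def by simp
  then show ?thesis
    unfolding regular_realization_def iter_der_gens kernel_field_truncation
    using differential_extension_gens_field range_gens
    by (intro conjI exI[of _ id]) (simp_all add: iter_der_gens_der bij_betw_def)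
qed

lemma principal_realization: "principal_realization \<delta> L base_map gens_field gens_der (\<lambda>i. gens (0, i))"
proof -
  \<comment> \<open>\<open>Suc\<close> makes already the first truncation longer than
    \<open>L\<close>.\<close>
  let ?Ls = "\<lambda>i. truncation (Suc (len L + i))"
  have "len L < len (?Ls 0)" by simp
  moreover have "generic_prolongation \<delta> L (?Ls 0)" by (rule generic_prolongation_start) simp
  moreover have "len (?Ls i) < len (?Ls (Suc i))" for i by simp
  moreover have "generic_prolongation \<delta> (?Ls i) (?Ls (Suc i))" for i
    by (rule generic_prolongation_truncation) simp_all
  ultimately show ?thesis
    unfolding principal_realization_def
    by (intro conjI exI[of _ ?Ls] allI regular_realization_start regular_realization_truncation)
qed

end

theorem theorem14:
  fixes \<delta> :: "'m::{finite,linorder} \<Rightarrow> 'k::field_char_0 \<Rightarrow> 'k"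
    and L :: "('k, 'm, 'n::{finite,linorder}, 'a::field_char_0) kernel"
  assumes "differential_field UNIV \<delta>"
    and "differential_kernel \<delta> L"
    and "\<And>\<tau> l i j.
      (\<tau>, l) \<in> gamma_set L - Gam (len L) \<Longrightarrow> i < j \<Longrightarrow>
      \<tau> i > 0 \<Longrightarrow> leader L (\<tau> - unit_idx i, l) \<Longrightarrow>
      \<tau> j > 0 \<Longrightarrow> leader L (\<tau> - unit_idx j, l) \<Longrightarrow>
      \<exists>(s::nat) (\<eta> :: nat \<Rightarrow> 'm \<Rightarrow> nat) (k :: nat \<Rightarrow> 'm).
        s \<ge> 1 \<and> k 1 = i \<and> k s = j \<and>
        (\<forall>q\<in>{1..s}. minimal_leader L (\<eta> q, l) \<and> \<tau> (k q) > 0 \<and> \<eta> q \<le> \<tau> - unit_idx (k q)) \<and>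
        (\<forall>q\<in>{1..<s}. mdeg (sup (\<eta> q) (\<eta> (Suc q))) \<le> len L)"
  shows "\<exists>(\<kappa> :: 'k \<Rightarrow> 'a ratfun) M d g. principal_realization \<delta> L \<kappa> M d g"
proof -
  interpret prolongable_kernel \<delta> L
    by unfold_locales (rule assms(1), rule assms(2), rule assms(3), assumption+)
  show ?thesis by (intro exI) (rule principal_realization)
qed

end
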